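(* Let $G=(V,E)$ be a finite connected graph with a subgroup of automorphisms $\Psi\le\mathrm{Aut}(G)$, and let $\lambda>0$ be a Laplacian eigenvalue of $G$. Let $\mathcal{E}_\lambda=X_1\oplus\cdots\oplus X_h$ be the isotypic decomposition of $\mathcal{E}_\lambda$ as a real $\Psi$-representation, where $X_i\cong\mathbb{R}^{m_i}\otimes U_i$ for distinct (pairwise non-isomorphic) real irreducible representations $U_i$ with $D_i\cong\mathrm{End}_\Psi(U_i)$. If $m_i\le\dim_{D_i}U_i$ for all $1\le i\le h$, then 1. $\ell_\Psi(\mathcal{E}_\lambda)=\{\ell_\Psi(\varphi):\varphi\in\mathcal{E}_\lambda\}$ is a convex cone, and 2. $G$ has an orbit-isometric embedding (with respect to $\Psi$) on $\mathcal{E}_\lambda$ if and only if there exists a single $\varphi\in\mathcal{E}_\lambda$ with $\ell_\Psi(\varphi)=\mathcal{O}$, where $\mathcal{O}=(|\mathcal{O}_1|,\dots,|\mathcal{O}_s|)$ is the vector of sizes of the edge orbits of $\Psi$.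
   Context: $G=(V,E)$ is a finite, connected, simple undirected graph with $n=|V|$ vertices. Its Laplacian $L$ is the symmetric matrix with $\langle\varphi,L\varphi\rangle=\sum_{uv\in E}(\varphi(u)-\varphi(v))^2$ for $\varphi\in\mathbb{R}^V$, and $\mathcal{E}_\lambda=\{\varphi\in\mathbb{R}^V:L\varphi=\lambda\varphi\}$. The group $\Psi$ acts on $\mathbb{R}^V$ by $(\sigma\cdot\varphi)(u)=\varphi(\sigma^{-1}(u))$; each $\mathcal{E}_\lambda$ is a subrepresentation. Here $\mathbb{R}^{m_i}$ carries the trivial action, so $m_i$ is the multiplicity of $U_i$ in $\mathcal{E}_\lambda$. By Schur's lemma each $D_i$ is one of $\mathbb{R},\mathbb{C},\mathbb{H}$ (quaternions), and $\dim_{D_i}U_i=\dim_{\mathbb{R}}U_i/\dim_{\mathbb{R}}D_i$. Let $\mathcal{O}_1,\dots,\mathcal{O}_s$ be the orbits of $\Psi$ on the edge set $E$. For $\varphi:V\to\mathbb{R}$, the orbit-energy vector is $\ell_\Psi(\varphi)=\big(\sum_{uv\in\mathcal{O}_i}(\varphi(u)-\varphi(v))^2\big)_{i=1}^s\in\mathbb{R}^s$. For $\varphi_1,\dots,\varphi_r\in\mathcal{E}_\lambda$ (any finite $r$), let $P=(\varphi_1\ \cdots\ \varphi_r)\in\mathbb{R}^{n\times r}$. The associated spectral embedding on $\mathcal{E}_\lambda$ is the family $\{p_v\}_{v\in V}\subseteq\mathbb{R}^r$ where $p_v^T$ is the $v$-th row of $P$. It is orbit-isometric with respect to $\Psi$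 if there is $c>0$ such that $\frac{1}{|\mathcal{O}_i|}\sum_{uv\in\mathcal{O}_i}\|p_u-p_v\|^2=c$ for all $1\le i\le s$. *)

theory Defs
  imports "HOL-Analysis.Analysis" "HOL-Algebra.Group_Action"
begin

section \<open>Graphs, automorphisms and the Laplacian\<close>

text \<open>The vertex set is the whole of a (nonempty) finite type, and $\mathbb{R}^V$ is the
  type \<^typ>\<open>real^'v\<close>. Edges are two-element sets of vertices.\<close>

definition simple_graph :: "'v set set \<Rightarrow> bool" where
  "simple_graph E \<longleftrightarrow> (\<forall>e\<in>E. card e = 2)"

definition connected_graph :: "'v set set \<Rightarrow> bool" where
  "connected_graph E \<longleftrightarrow> (\<forall>u v. (u, v) \<in> {(x, y). {x, y} \<in> E}\<^sup>*)"

definition Aut :: "'v set set \<Rightarrow> ('v \<Rightarrow> 'v) monoid" where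
  "Aut E = \<lparr>carrier = {\<sigma>. bij \<sigma> \<and> (\<forall>u v. {\<sigma> u, \<sigma> v} \<in> E \<longleftrightarrow> {u, v} \<in> E)},
            monoid.mult = (\<circ>), one = id\<rparr>"

definition laplacian :: "'v::finite set set \<Rightarrow> real^'v^'v" where
  "laplacian E = (\<chi> u v. if u = v then real (card {w. {u, w} \<in> E})
                         else if {u, v} \<in> E then -1 else 0)"

definition eigenspace :: "'v::finite set set \<Rightarrow> real \<Rightarrow> (real^'v) set" where
  "eigenspace E lam = {\<phi>. laplacian E *v \<phi> = lam *\<^sub>R \<phi>}"

definition laplacian_eigenvalue :: "'v::finite set set \<Rightarrow> real \<Rightarrow> bool" where
  "laplacian_eigenvalue E lam \<longleftrightarrow> (\<exists>\<phi>\<in>eigenspace E lam. \<phi> \<noteq> 0)"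

text \<open>The value of an expression \<open>f u v\<close> at an unordered edge \<open>uv\<close>; it is meaningful for
  symmetric \<open>f\<close> only, see \<open>on_edge_eq\<close> below.\<close>

definition on_edge :: "('v \<Rightarrow> 'v \<Rightarrow> 'b) \<Rightarrow> 'v set \<Rightarrow> 'b" where
  "on_edge f e = the_elem {f u v | u v. e = {u, v}}"

lemma on_edge_eq:
  assumes "\<And>u v. f u v = f v u"
  shows "on_edge f {u, v} = f u v"
proof -
  have "{f x y | x y. {u, v} = {x, y}} = {f u v}"
    using assms by (auto simp: doubleton_eq_iff)
  then show ?thesis
    by (simp add: on_edge_def)
qed

section \<open>Edge orbits, orbit energies and orbit-isometric embeddings\<close>

text \<open>For a subgroup \<open>\<Psi>\<close> of \<open>Aut E\<close>, the group \<open>\<Psi>\<close> itself is \<open>(Aut E)\<lparr>carrier := \<Psi>\<rparr>\<close>.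
  It acts on edges by taking images.\<close>

definition edge_orbits :: "'v set set \<Rightarrow> ('v \<Rightarrow> 'v) set \<Rightarrow> 'v set set set" where
  "edge_orbits E \<Psi> = orbits ((Aut E)\<lparr>carrier := \<Psi>\<rparr>) E (\<lambda>\<sigma> e. \<sigma> ` e)"

text \<open>In the rest of this section \<open>Orb\<close> is an enumeration of the edge orbits by a
  finite index type \<open>'s\<close>, so that $\mathbb{R}^s$ is \<^typ>\<open>real^'s\<close>.\<close>

definition orbit_energy :: "('s::finite \<Rightarrow> 'v::finite set set) \<Rightarrow> real^'v \<Rightarrow> real^'s" where
  "orbit_energy Orb \<phi> = (\<chi> i. \<Sum>e\<in>Orb i. on_edge (\<lambda>u v. (\<phi> $ u - \<phi> $ v)\<^sup>2) e)"

definition orbit_sizes :: "('s::finite \<Rightarrow> 'v::finite set set) \<Rightarrow> real^'s" where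
  "orbit_sizes Orb = (\<chi> i. real (card (Orb i)))"

text \<open>The point $p_v \in \mathbb{R}^r$ has coordinates \<open>\<phi> j $ v\<close>, \<open>j < r\<close>.
  As \<open>r\<close> is arbitrary, the Euclidean norm of $\mathbb{R}^r$ is \<open>L2_set _ {..<r}\<close>.\<close>

definition orbit_isometric ::
    "('s::finite \<Rightarrow> 'v::finite set set) \<Rightarrow> nat \<Rightarrow> (nat \<Rightarrow> real^'v) \<Rightarrow> bool" where
  "orbit_isometric Orb r \<phi> \<longleftrightarrow>
     (\<exists>c>0. \<forall>i. (1 / real (card (Orb i))) *
        (\<Sum>e\<in>Orb i. on_edge (\<lambda>u v. (L2_set (\<lambda>j. \<phi> j $ u - \<phi> j $ v) {..<r})\<^sup>2) e) = c)"

definition has_orbit_isometric_embedding ::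
    "('s::finite \<Rightarrow> 'v::finite set set) \<Rightarrow> (real^'v) set \<Rightarrow> bool" where
  "has_orbit_isometric_embedding Orb W \<longleftrightarrow>
     (\<exists>r \<phi>. (\<forall>j<r. \<phi> j \<in> W) \<and> orbit_isometric Orb r \<phi>)"

section \<open>Real representations\<close>

text \<open>A representation consists of a subspace \<open>W\<close> of some \<^typ>\<open>real^'k\<close> and an action \<open>\<rho>\<close>.
  Only the values of \<open>\<rho> g\<close> on \<open>W\<close> matter.\<close>

definition linear_between :: "('a::real_vector) set \<Rightarrow> ('b::real_vector) set \<Rightarrow> ('a \<Rightarrow> 'b) \<Rightarrow> bool" where
  "linear_between W W' T \<longleftrightarrow> (\<forall>x\<in>W. T x \<in> W') \<and>
     (\<forall>x\<in>W. \<forall>y\<in>W. T (x + y) = T x + T y) \<and> (\<forall>c. \<forall>x\<in>W. T (c *\<^sub>R x) = c *\<^sub>R T x)"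

definition representation ::
    "('g, 'm) monoid_scheme \<Rightarrow> (real^'k) set \<Rightarrow> ('g \<Rightarrow> real^'k \<Rightarrow> real^'k) \<Rightarrow> bool" where
  "representation G W \<rho> \<longleftrightarrow> subspace W \<and>
     (\<forall>g\<in>carrier G. linear_between W W (\<rho> g)) \<and>
     (\<forall>g\<in>carrier G. \<forall>h\<in>carrier G. \<forall>x\<in>W. \<rho> (g \<otimes>\<^bsub>G\<^esub> h) x = \<rho> g (\<rho> h x)) \<and>
     (\<forall>x\<in>W. \<rho> \<one>\<^bsub>G\<^esub> x = x)"

definition subrepresentation ::
    "('g, 'm) monoid_scheme \<Rightarrow> (real^'k) set \<Rightarrow> ('g \<Rightarrow> real^'k \<Rightarrow> real^'k) \<Rightarrow> (real^'k) set \<Rightarrow> bool" where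
  "subrepresentation G W \<rho> S \<longleftrightarrow> subspace S \<and> S \<subseteq> W \<and> (\<forall>g\<in>carrier G. \<forall>x\<in>S. \<rho> g x \<in> S)"

definition irreducible_rep ::
    "('g, 'm) monoid_scheme \<Rightarrow> (real^'k) set \<Rightarrow> ('g \<Rightarrow> real^'k \<Rightarrow> real^'k) \<Rightarrow> bool" where
  "irreducible_rep G W \<rho> \<longleftrightarrow> representation G W \<rho> \<and> W \<noteq> {0} \<and>
     (\<forall>S. subrepresentation G W \<rho> S \<longrightarrow> S = {0} \<or> S = W)"

definition intertwiner ::
    "('g, 'm) monoid_scheme \<Rightarrow> (real^'k) set \<Rightarrow> ('g \<Rightarrow> real^'k \<Rightarrow> real^'k) \<Rightarrow>
     (real^'l) set \<Rightarrow> ('g \<Rightarrow> real^'l \<Rightarrow> real^'l) \<Rightarrow> (real^'k \<Rightarrow> real^'l) \<Rightarrow> bool" where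
  "intertwiner G W \<rho> W' \<rho>' T \<longleftrightarrow> linear_between W W' T \<and>
     (\<forall>g\<in>carrier G. \<forall>x\<in>W. T (\<rho> g x) = \<rho>' g (T x))"

definition rep_isomorphic ::
    "('g, 'm) monoid_scheme \<Rightarrow> (real^'k) set \<Rightarrow> ('g \<Rightarrow> real^'k \<Rightarrow> real^'k) \<Rightarrow>
     (real^'l) set \<Rightarrow> ('g \<Rightarrow> real^'l \<Rightarrow> real^'l) \<Rightarrow> bool" where
  "rep_isomorphic G W \<rho> W' \<rho>' \<longleftrightarrow>
     (\<exists>T. intertwiner G W \<rho> W' \<rho>' T \<and> bij_betw T W W')"

text \<open>The endomorphism algebra of \<open>(W, \<rho>)\<close>. To be able to use the library's \<^const>\<open>dim\<close>, an
  endomorphism of \<open>W\<close> is encoded as the matrix of its unique linear extension that vanishes on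
  the orthogonal complement of \<open>W\<close>.\<close>

definition End_rep ::
    "('g, 'm) monoid_scheme \<Rightarrow> (real^'k) set \<Rightarrow> ('g \<Rightarrow> real^'k \<Rightarrow> real^'k) \<Rightarrow> (real^'k^'k) set" where
  "End_rep G W \<rho> =
     {A. intertwiner G W \<rho> W \<rho> ((*v) A) \<and> (\<forall>x\<in>orthogonal_comp W. A *v x = 0)}"

text \<open>For irreducible \<open>(W, \<rho>)\<close> with division algebra \<open>D = End_rep G W \<rho>\<close> this is $\dim_D W =
  \dim_{\mathbb{R}} W / \dim_{\mathbb{R}} D$.\<close>

definition dim_over_End ::
    "('g, 'm) monoid_scheme \<Rightarrow> (real^'k) set \<Rightarrow> ('g \<Rightarrow> real^'k \<Rightarrow> real^'k) \<Rightarrow> real" where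
  "dim_over_End G W \<rho> = real (dim W) / real (dim (End_rep G W \<rho>))"

text \<open>The internal direct sum \<open>W = X 1 \<oplus> \<dots> \<oplus> X h\<close>: every element of \<open>W\<close> is a sum of elements of
  the \<open>X i\<close> in exactly one way.\<close>

definition direct_sum_decomposition ::
    "('a::real_vector) set \<Rightarrow> nat \<Rightarrow> (nat \<Rightarrow> 'a set) \<Rightarrow> bool" where
  "direct_sum_decomposition W h X \<longleftrightarrow> (\<forall>i\<in>{1..h}. subspace (X i)) \<and>
     bij_betw (\<lambda>x. \<Sum>i\<in>{1..h}. x i) (\<Pi>\<^sub>E i\<in>{1..h}. X i) W"

text \<open>\<open>X\<close> is isomorphic to $\mathbb{R}^m \otimes U$, where $\mathbb{R}^m$ carries the trivial
  action. With the standard basis $e_0, \dots, e_{m-1}$ of $\mathbb{R}^m$, every tensor is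
  $\sum_{k<m} e_k \otimes y_k$ for a unique tuple $(y_k)$ of elements of \<open>U\<close>, and the group acts
  on each $y_k$. A homomorphism from $\mathbb{R}^m \otimes U$ is therefore given by the
  homomorphisms \<open>J k\<close> from \<open>U\<close>, with \<open>J k y\<close> the image of $e_k \otimes y$.\<close>

definition isomorphic_to_multiple ::
    "('g, 'm) monoid_scheme \<Rightarrow> (real^'l) set \<Rightarrow> ('g \<Rightarrow> real^'l \<Rightarrow> real^'l) \<Rightarrow>
     nat \<Rightarrow> (real^'k) set \<Rightarrow> ('g \<Rightarrow> real^'k \<Rightarrow> real^'k) \<Rightarrow> bool" where
  "isomorphic_to_multiple G X \<tau> m U \<rho> \<longleftrightarrow>
     (\<exists>J. (\<forall>k<m. intertwiner G U \<rho> X \<tau> (J k)) \<and>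
          bij_betw (\<lambda>y. \<Sum>k<m. J k (y k)) ({..<m} \<rightarrow>\<^sub>E U) X)"

definition isotypic_decomposition ::
    "('g, 'm) monoid_scheme \<Rightarrow> (real^'l) set \<Rightarrow> ('g \<Rightarrow> real^'l \<Rightarrow> real^'l) \<Rightarrow> nat \<Rightarrow>
     (nat \<Rightarrow> (real^'l) set) \<Rightarrow> (nat \<Rightarrow> nat) \<Rightarrow>
     (nat \<Rightarrow> (real^'k) set) \<Rightarrow> (nat \<Rightarrow> 'g \<Rightarrow> real^'k \<Rightarrow> real^'k) \<Rightarrow> bool" where
  "isotypic_decomposition G W \<tau> h X m U \<rho> \<longleftrightarrow>
     direct_sum_decomposition W h X \<and>
     (\<forall>i\<in>{1..h}. subrepresentation G W \<tau> (X i)) \<and>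
     (\<forall>i\<in>{1..h}. irreducible_rep G (U i) (\<rho> i)) \<and>
     (\<forall>i\<in>{1..h}. \<forall>j\<in>{1..h}. i \<noteq> j \<longrightarrow> \<not> rep_isomorphic G (U i) (\<rho> i) (U j) (\<rho> j)) \<and>
     (\<forall>i\<in>{1..h}. isomorphic_to_multiple G (X i) \<tau> (m i) (U i) (\<rho> i))"

text \<open>The action $(\sigma \cdot \varphi)(u) = \varphi(\sigma^{-1}(u))$; here \<open>inv_into UNIV \<sigma>\<close> is the
  inverse function (the notation \<open>inv\<close> is also used for inverses in a group).\<close>

definition vertex_action :: "('v::finite \<Rightarrow> 'v) \<Rightarrow> real^'v \<Rightarrow> real^'v" where
  "vertex_action \<sigma> \<phi> = (\<chi> u. \<phi> $ (inv_into UNIV \<sigma> u))"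

section \<open>Checks of the definitions\<close>

text \<open>\<open>laplacian E\<close> is the only symmetric matrix with quadratic form
  $\langle\varphi, L\varphi\rangle = \sum_{uv \in E} (\varphi(u) - \varphi(v))^2$.
  Moreover \<open>Aut E\<close> is a group, \<open>vertex_action\<close> is a representation of its subgroups, and the
  eigenspaces of the Laplacian are subrepresentations.\<close>

lemma sum_on_edge:
  fixes f :: "'v::finite \<Rightarrow> 'v \<Rightarrow> real"
  assumes E: "simple_graph E" and sym: "\<And>u v. f u v = f v u"
  shows "(\<Sum>e\<in>E. on_edge f e) = (\<Sum>u\<in>UNIV. \<Sum>v | {u, v} \<in> E. f u v) / 2"
proof -
  let ?P = "{(u, v). {u, v} \<in> E}"
  have fib: "(\<Sum>x | x \<in> ?P \<and> (\<lambda>(u, v). {u, v}) x = e. case_prod f x) = 2 * on_edge f e"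
    if "e \<in> E" for e
  proof -
    have "card e = 2"
      using that E by (simp add: simple_graph_def)
    then obtain a b where e: "e = {a, b}" "a \<noteq> b"
      by (auto simp: card_2_iff)
    have "{x. x \<in> ?P \<and> (\<lambda>(u, v). {u, v}) x = e} = {(a, b), (b, a)}"
      using that e by (auto simp: doubleton_eq_iff insert_commute)
    then show ?thesis
      using e sym[of a b] on_edge_eq[of f a b, OF sym] by simp
  qed
  have "(\<Sum>u\<in>UNIV. \<Sum>v | {u, v} \<in> E. f u v) = (\<Sum>x\<in>?P. case_prod f x)"
    by (subst sum.Sigma) (auto intro!: sum.cong)
  also have "\<dots> = (\<Sum>e\<in>E. \<Sum>x | x \<in> ?P \<and> (\<lambda>(u, v). {u, v}) x = e. case_prod f x)"
    by (intro sum.group[symmetric]) auto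
  also have "\<dots> = 2 * (\<Sum>e\<in>E. on_edge f e)"
    unfolding sum_distrib_left by (intro sum.cong refl fib)
  finally show ?thesis by simp
qed

lemma transpose_laplacian: "transpose (laplacian E) = laplacian E"
  by (simp add: vec_eq_iff transpose_def laplacian_def insert_commute)

lemma laplacian_mult:
  assumes E: "simple_graph E"
  shows "(laplacian E *v \<phi>) $ u = (\<Sum>v | {u, v} \<in> E. \<phi> $ u - \<phi> $ v)"
proof -
  have nl: "{u, u} \<notin> E"
    using E by (auto simp: simple_graph_def)
  have "(laplacian E *v \<phi>) $ u
      = (\<Sum>v\<in>UNIV. (if v = u then real (card {w. {u, w} \<in> E}) * \<phi> $ u else 0)
                    - (if {u, v} \<in> E then \<phi> $ v else 0))"
    using nl by (auto simp: matrix_vector_mult_def laplacian_def intro!: sum.cong)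
  also have "\<dots> = (\<Sum>v | {u, v} \<in> E. \<phi> $ u - \<phi> $ v)"
    by (simp add: sum_subtractf sum.If_cases)
  finally show ?thesis .
qed

lemma laplacian_quadratic_form:
  assumes E: "simple_graph E"
  shows "\<phi> \<bullet> (laplacian E *v \<phi>) = (\<Sum>e\<in>E. on_edge (\<lambda>u v. (\<phi> $ u - \<phi> $ v)\<^sup>2) e)"
proof -
  let ?N = "\<lambda>u. {v. {u, v} \<in> E}"
  have swap: "(\<Sum>u\<in>UNIV. \<Sum>v\<in>?N u. g u v) = (\<Sum>u\<in>UNIV. \<Sum>v\<in>?N u. g v u)"
    for g :: "'a \<Rightarrow> 'a \<Rightarrow> real"
    using sum.swap_restrict[of UNIV UNIV g "\<lambda>u v. {u, v} \<in> E"]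
    by (simp add: insert_commute)
  have "2 * (\<phi> \<bullet> (laplacian E *v \<phi>))
      = 2 * (\<Sum>u\<in>UNIV. \<Sum>v\<in>?N u. \<phi> $ u * (\<phi> $ u - \<phi> $ v))"
    by (simp add: inner_vec_def laplacian_mult[OF E] sum_distrib_left)
  also have "\<dots> = (\<Sum>u\<in>UNIV. \<Sum>v\<in>?N u. \<phi> $ u * (\<phi> $ u - \<phi> $ v))
      + (\<Sum>u\<in>UNIV. \<Sum>v\<in>?N u. \<phi> $ v * (\<phi> $ v - \<phi> $ u))"
    using swap[of "\<lambda>u v. \<phi> $ u * (\<phi> $ u - \<phi> $ v)"] by simp
  also have "\<dots> = (\<Sum>u\<in>UNIV. \<Sum>v\<in>?N u. (\<phi> $ u - \<phi> $ v)\<^sup>2)"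
    by (simp add: sum.distrib[symmetric] power2_eq_square algebra_simps)
  also have "\<dots> = 2 * (\<Sum>e\<in>E. on_edge (\<lambda>u v. (\<phi> $ u - \<phi> $ v)\<^sup>2) e)"
    by (subst sum_on_edge[OF E]) (auto simp: power2_commute)
  finally show ?thesis by simp
qed

lemma laplacian_unique:
  assumes E: "simple_graph E" and A: "transpose A = A"
    and q: "\<And>\<phi>. \<phi> \<bullet> (A *v \<phi>) = (\<Sum>e\<in>E. on_edge (\<lambda>u v. (\<phi> $ u - \<phi> $ v)\<^sup>2) e)"
  shows "A = laplacian E"
proof -
  define B where "B = A - laplacian E"
  have B0: "x \<bullet> (B *v x) = 0" for x
    using q[of x] laplacian_quadratic_form[OF E, of x]
    by (simp add: B_def matrix_vector_mult_diff_rdistrib inner_diff_right)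
  have "transpose B = B"
    using A transpose_laplacian[of E]
    by (simp add: B_def transpose_def vec_eq_iff)
  then have "x \<bullet> (B *v y) = y \<bullet> (B *v x)" for x y
    by (metis dot_lmul_matrix inner_commute vector_transpose_matrix)
  moreover have "x \<bullet> (B *v y) + y \<bullet> (B *v x) = 0" for x y
    using B0[of "x + y"] B0[of x] B0[of y]
    by (simp add: matrix_vector_right_distrib inner_add_left inner_add_right)
  ultimately have "x \<bullet> (B *v y) = 0" for x y
    by (smt (verit))
  then have "B *v y = 0" for y
    using inner_eq_zero_iff by blast
  then have "B = 0"
    by (simp add: matrix_eq)
  then show ?thesis by (simp add: B_def)
qed

lemma group_Aut: "group (Aut E)"
proof (rule groupI)
  fix s assume s: "s \<in> carrier (Aut E)"
  then have b: "bij s" by (simp add: Aut_def)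
  have "inv_into UNIV s \<in> carrier (Aut E)"
    using s b bij_imp_bij_inv[OF b]
    by (simp add: Aut_def) (metis bij_is_surj surj_f_inv_f)
  then show "\<exists>t\<in>carrier (Aut E). t \<otimes>\<^bsub>Aut E\<^esub> s = \<one>\<^bsub>Aut E\<^esub>"
    using b by (intro bexI[of _ "inv_into UNIV s"]) (auto simp: Aut_def bij_is_inj inv_o_cancel)
qed (auto simp: Aut_def bij_comp comp_assoc)

lemma representation_vertex_action:
  assumes "subgroup P (Aut E)"
  shows "representation ((Aut E)\<lparr>carrier := P\<rparr>) UNIV vertex_action"
proof -
  have b: "bij s" if "s \<in> P" for s
    using subgroup.subset[OF assms] that by (auto simp: Aut_def)
  have c: "vertex_action (s \<circ> t) x = vertex_action s (vertex_action t x)"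
    if "s \<in> P" "t \<in> P" for s t x
    using o_inv_distrib[OF b[OF that(1)] b[OF that(2)]]
    by (simp add: vertex_action_def)
  show ?thesis
    using c by (auto simp: representation_def linear_between_def Aut_def vertex_action_def vec_eq_iff)
qed

lemma subrepresentation_eigenspace:
  assumes "subgroup P (Aut E)" and E: "simple_graph E"
  shows "subrepresentation ((Aut E)\<lparr>carrier := P\<rparr>) UNIV vertex_action (eigenspace E lam)"
proof -
  have "laplacian E *v vertex_action s x = vertex_action s (laplacian E *v x)" if "s \<in> P" for s x
  proof -
    let ?t = "inv_into UNIV s"
    have s: "bij s" "\<And>u v. {s u, s v} \<in> E \<longleftrightarrow> {u, v} \<in> E"
      using subgroup.subset[OF assms(1)] that by (auto simp: Aut_def)
    have st: "s (?t u) = u" "?t (s u) = u" for u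
      using s(1) by (simp_all add: bij_is_surj surj_f_inv_f bij_is_inj)
    have "(\<Sum>v | {u, v} \<in> E. x $ ?t u - x $ ?t v) = (\<Sum>v | {?t u, v} \<in> E. x $ ?t u - x $ v)" for u
      by (rule sum.reindex_bij_witness[of _ s ?t]) (use s(2) st in \<open>auto, metis+\<close>)
    then show ?thesis
      by (simp add: vec_eq_iff laplacian_mult[OF E] vertex_action_def)
  qed
  moreover have "vertex_action s (c *\<^sub>R x) = c *\<^sub>R vertex_action s x" for s c and x :: "real^'a"
    by (simp add: vertex_action_def vec_eq_iff)
  ultimately show ?thesis
    by (auto simp: subrepresentation_def eigenspace_def subspace_def matrix_vector_right_distrib
      scaleR_right_distrib matrix_vector_mult_scaleR)
qed

end

theory Submission
  imports Defs
begin

text \<open>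
  Every coordinate of the orbit energy is a quadratic form \<open>\<phi> \<bullet> L \<phi>\<close>, where \<open>L\<close> is the Laplacian of
  the graph whose edges form one orbit; as the orbit is invariant, \<open>L\<close> commutes with the group.
  Homogeneity of these forms makes their image closed under nonnegative scaling, so it has to be
  closed under addition: given \<open>\<phi>\<close> and \<open>\<psi>\<close> in the eigenspace there must be a \<open>\<theta>\<close> in it with
  \<open>\<theta> \<bullet> Q \<theta> = \<phi> \<bullet> Q \<phi> + \<psi> \<bullet> Q \<psi>\<close> for all equivariant \<open>Q\<close> at once. This is the lemma
  \<open>invariant_forms_add\<close>. An orbit-isometric embedding is a family whose energies add up to a
  positive multiple of the vector of orbit sizes, so the second claim follows from the first one
  by rescaling.

  To find \<open>\<theta>\<close>, replace each irreducible \<open>U\<close> that occurs by an isomorphic subspace \<open>V\<close> of the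
  eigenspace, on which the group acts by isometries, and write vectors of the isotypic component as
  sums of images of \<open>m\<close> vectors of \<open>V\<close> under equivariant maps. Expanding \<open>\<theta> \<bullet> Q \<theta>\<close> and using
  adjoints, all terms take the form \<open>z k \<bullet> f (z l)\<close> with \<open>f\<close> an intertwiner between two of the \<open>V\<close>;
  by Schur's lemma only those with \<open>f\<close> in the division algebra \<open>D\<close> of a single \<open>V\<close> survive. Hence it
  suffices to find, for tuples \<open>x\<close> and \<open>y\<close> of \<open>m\<close> vectors of \<open>V\<close>, a tuple \<open>z\<close> with
  \<open>z k \<bullet> f (z l) = x k \<bullet> f (x l) + y k \<bullet> f (y l)\<close> for all \<open>f\<close> in \<open>D\<close>.

  In other words, the span over \<open>D\<close> of the \<open>m\<close> vectors \<open>(x k, y k)\<close> of \<open>V \<times> V\<close> must be embedded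
  isometrically into \<open>V\<close>. This is done one vector at a time in \<open>gram_realization\<close>: the part of the
  new vector in the span over \<open>D\<close> of the previous ones is copied, and the orthogonal part is
  replaced by a vector of equal length that is orthogonal to the span constructed so far. There is
  room for it as long as the number of vectors is at most the dimension of \<open>V\<close> over \<open>D\<close>. Only
  the length matters, because a self-adjoint element of \<open>D\<close> is a real scalar, so that \<open>u \<bullet> f u\<close> is
  a multiple of \<open>u \<bullet> u\<close> by a factor depending on \<open>f\<close> alone. Thus real, complex and quaternionic
  division algebras need not be distinguished.
\<close>

section \<open>Linear maps on subspaces\<close>

lemma linear_between_zero:
  "linear_between W W' T \<Longrightarrow> subspace W \<Longrightarrow> T 0 = 0"
  unfolding linear_between_def by (metis scaleR_zero_left subspace_0)

lemma linear_between_sum: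
  assumes T: "linear_between W W' T" and W: "subspace W"
    and "finite A" and "\<And>i. i \<in> A \<Longrightarrow> f i \<in> W"
  shows "T (\<Sum>i\<in>A. f i) = (\<Sum>i\<in>A. T (f i))"
  using assms(3,4)
proof (induction A rule: finite_induct)
  case empty
  then show ?case using linear_between_zero[OF T W] by simp
next
  case (insert a A)
  then have "f a \<in> W" "(\<Sum>i\<in>A. f i) \<in> W"
    using W by (auto intro: subspace_sum)
  then show ?case using insert T unfolding linear_between_def by simp
qed

text \<open>A map that is linear on a subspace only is turned into a total one, so that the library's
  results on linear maps apply. The extension by zero on the orthogonal complement is the one that
  represents endomorphisms as matrices in \<^const>\<open>End_rep\<close>.\<close>

lemma linear_between_extension:
  fixes U :: "'a::euclidean_space set" and T :: "'a \<Rightarrow> 'b::real_vector"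
  assumes T: "linear_between U W T" and U: "subspace U"
  obtains F where "linear F" "\<And>x. x \<in> U \<Longrightarrow> F x = T x" "\<And>x. x \<in> orthogonal_comp U \<Longrightarrow> F x = 0"
proof -
  obtain B where B: "B \<subseteq> U" "pairwise orthogonal B" "\<And>x. x \<in> B \<Longrightarrow> norm x = 1"
    "independent B" "span B = U"
    using orthonormal_basis_subspace[OF U] by metis
  have fin: "finite B" using B(4) by (simp add: independent_imp_finite)
  define F where "F x = (\<Sum>b\<in>B. (x \<bullet> b) *\<^sub>R T b)" for x
  have "linear F"
    by (rule linearI) (simp_all add: F_def inner_add_left scaleR_add_left sum.distrib scaleR_sum_right)
  moreover have "F x = T x" if "x \<in> U" for x
  proof -
    have "T x = T (\<Sum>b\<in>B. (x \<bullet> b) *\<^sub>R b)"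
      using orthonormal_basis_expand[OF B(2,3) _ fin, of x] that B(5) by simp
    also have "\<dots> = (\<Sum>b\<in>B. T ((x \<bullet> b) *\<^sub>R b))"
      using B(1) U by (intro linear_between_sum[OF T U fin]) (auto intro: subspace_scale)
    also have "\<dots> = F x"
      using T B(1) unfolding F_def linear_between_def by (intro sum.cong) auto
    finally show ?thesis by simp
  qed
  moreover have "F x = 0" if "x \<in> orthogonal_comp U" for x
    using that B(1) unfolding F_def orthogonal_comp_def orthogonal_def
    by (intro sum.neutral) (auto simp: inner_commute subset_iff)
  ultimately show thesis using that by blast
qed

text \<open>The extension by zero has an adjoint whose range is orthogonal to the orthogonal complement
  of \<open>U\<close>, that is, contained in \<open>U\<close>.\<close>

lemma linear_between_adjoint:
  fixes U :: "'a::euclidean_space set" and T :: "'a \<Rightarrow> 'b::euclidean_space"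
  assumes T: "linear_between U W T" and U: "subspace U"
  obtains S where "linear S" "\<And>y. S y \<in> U" "\<And>x y. x \<in> U \<Longrightarrow> T x \<bullet> y = x \<bullet> S y"
proof -
  obtain F where F: "linear F" "\<And>x. x \<in> U \<Longrightarrow> F x = T x" "\<And>x. x \<in> orthogonal_comp U \<Longrightarrow> F x = 0"
    using linear_between_extension[OF T U] by metis
  have adj: "F x \<bullet> y = x \<bullet> adjoint F y" for x y
    using adjoint_works[OF F(1)] by simp
  have "x \<bullet> adjoint F y = 0" if "x \<in> orthogonal_comp U" for x y
    using F(3)[OF that] adj[of x y] by simp
  then have "adjoint F y \<in> orthogonal_comp (orthogonal_comp U)" for y
    by (simp add: orthogonal_comp_def[of "orthogonal_comp U"] orthogonal_def)
  then have "adjoint F y \<in> U" for y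
    by (simp add: orthogonal_comp_self[OF U])
  moreover have "T x \<bullet> y = x \<bullet> adjoint F y" if "x \<in> U" for x y
    using adj[of x y] F(2)[OF that] by simp
  ultimately show thesis
    using that[of "adjoint F"] adjoint_linear[OF F(1)] by simp
qed

lemma dim_UN_le:
  fixes A :: "nat \<Rightarrow> 'a::euclidean_space set"
  assumes "\<And>k. k < n \<Longrightarrow> dim (A k) \<le> d"
  shows "dim (\<Union>k<n. A k) \<le> n * d"
proof -
  have "\<exists>B. finite B \<and> card B = dim (A k) \<and> A k \<subseteq> span B" for k
    using basis_exists[of "A k"] by (metis independent_imp_finite)
  then obtain B where B: "\<And>k. finite (B k) \<and> card (B k) = dim (A k) \<and> A k \<subseteq> span (B k)"
    by metis
  have "A k \<subseteq> span (\<Union>k<n. B k)" if "k < n" for k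
    using B[of k] span_mono[of "B k" "\<Union>k<n. B k"] that by blast
  then have "dim (\<Union>k<n. A k) \<le> card (\<Union>k<n. B k)"
    using B by (intro dim_le_card) auto
  also have "\<dots> \<le> (\<Sum>k<n. card (B k))"
    by (rule card_UN_le) simp
  also have "\<dots> \<le> n * d"
    using sum_bounded_above[of "{..<n}" "\<lambda>k. card (B k)" d] B assms by simp
  finally show ?thesis .
qed

section \<open>Intertwiners and Schur's lemma\<close>

lemma intertwiner_mono:
  "intertwiner G W \<rho> W' \<rho>' T \<Longrightarrow> S \<subseteq> W \<Longrightarrow> W' \<subseteq> S' \<Longrightarrow> intertwiner G S \<rho> S' \<rho>' T"
  unfolding intertwiner_def linear_between_def by (auto simp: subset_iff)

lemma intertwiner_comp:
  "intertwiner G W \<rho> W' \<rho>' T \<Longrightarrow> intertwiner G W' \<rho>' W'' \<rho>'' S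
    \<Longrightarrow> intertwiner G W \<rho> W'' \<rho>'' (\<lambda>x. S (T x))"
  unfolding intertwiner_def linear_between_def by auto

lemma intertwiner_in: "intertwiner G W \<rho> W' \<rho>' T \<Longrightarrow> x \<in> W \<Longrightarrow> T x \<in> W'"
  unfolding intertwiner_def linear_between_def by auto

lemma intertwiner_cong:
  assumes W: "representation G W \<rho>" and T: "intertwiner G W \<rho> W' \<rho>' T"
    and eq: "\<And>x. x \<in> W \<Longrightarrow> S x = T x"
  shows "intertwiner G W \<rho> W' \<rho>' S"
proof -
  have "x + y \<in> W" "c *\<^sub>R x \<in> W" if "x \<in> W" "y \<in> W" for x y c
    using W that by (auto simp: representation_def subspace_add subspace_scale)
  moreover have "\<rho> g x \<in> W" if "g \<in> carrier G" "x \<in> W" for g x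
    using W that unfolding representation_def linear_between_def by blast
  ultimately show ?thesis
    using T unfolding intertwiner_def linear_between_def by (simp add: eq)
qed

lemma intertwiner_extension:
  assumes "representation G W \<rho>" and "intertwiner G W \<rho> W' \<rho>' T"
  obtains F where "linear F" "\<And>x. x \<in> W \<Longrightarrow> F x = T x"
    "\<And>x. x \<in> orthogonal_comp W \<Longrightarrow> F x = 0"
proof -
  have "linear_between W W' T" "subspace W"
    using assms by (auto simp: intertwiner_def representation_def)
  then show thesis by (rule linear_between_extension) (rule that)
qed

lemma intertwiner_zero:
  assumes "representation G W' \<rho>'"
  shows "intertwiner G W \<rho> W' \<rho>' (\<lambda>x. 0)"
proof -
  have "0 \<in> W'" "\<And>g. g \<in> carrier G \<Longrightarrow> \<rho>' g 0 = 0"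
    using assms linear_between_zero[of W' W'] by (auto simp: representation_def subspace_0)
  then show ?thesis by (simp add: intertwiner_def linear_between_def)
qed

lemma intertwiner_add:
  assumes "representation G W' \<rho>'" "intertwiner G W \<rho> W' \<rho>' S" "intertwiner G W \<rho> W' \<rho>' T"
  shows "intertwiner G W \<rho> W' \<rho>' (\<lambda>x. S x + T x)"
  using assms unfolding intertwiner_def representation_def linear_between_def
  by (auto simp: subspace_add scaleR_add_right)

lemma intertwiner_scaleR:
  assumes "representation G W' \<rho>'" "intertwiner G W \<rho> W' \<rho>' T"
  shows "intertwiner G W \<rho> W' \<rho>' (\<lambda>x. c *\<^sub>R T x)"
  using assms unfolding intertwiner_def representation_def linear_between_def
  by (auto simp: subspace_scale scaleR_add_right)

lemma representation_subspace: "representation G W \<rho> \<Longrightarrow> subspace W"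
  unfolding representation_def by auto

lemma irreducible_rep_representation: "irreducible_rep G W \<rho> \<Longrightarrow> representation G W \<rho>"
  by (simp add: irreducible_rep_def)

lemma representation_subrep:
  "representation G W \<rho> \<Longrightarrow> subrepresentation G W \<rho> S \<Longrightarrow> representation G S \<rho>"
  unfolding representation_def subrepresentation_def linear_between_def by (auto simp: subset_iff)

lemma subrepresentation_kernel:
  assumes W: "representation G W \<rho>" and W': "representation G W' \<rho>'"
    and T: "intertwiner G W \<rho> W' \<rho>' T"
  shows "subrepresentation G W \<rho> {x \<in> W. T x = 0}"
proof -
  have "T 0 = 0" "\<forall>g\<in>carrier G. \<rho>' g 0 = 0"
    using W W' T linear_between_zero unfolding intertwiner_def representation_def by blast+
  then show ?thesis
    using W W' T unfolding subrepresentation_def representation_def intertwiner_def linear_between_def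
      subspace_def by auto
qed

lemma subrepresentation_image:
  assumes W: "representation G W \<rho>" and T: "intertwiner G W \<rho> W' \<rho>' T"
  shows "subrepresentation G W' \<rho>' (T ` W)"
proof -
  have "T 0 = 0"
    using W T linear_between_zero unfolding intertwiner_def representation_def by blast
  moreover have "0 \<in> W" using W by (simp add: representation_def subspace_0)
  ultimately have "0 \<in> T ` W" by force
  then show ?thesis
    using W T unfolding subrepresentation_def representation_def intertwiner_def linear_between_def
      subspace_def by (auto simp: image_iff) metis+
qed

lemma intertwiner_inj_on:
  assumes W: "representation G W \<rho>" and T: "intertwiner G W \<rho> W' \<rho>' T"
    and ker: "\<And>x. x \<in> W \<Longrightarrow> T x = 0 \<Longrightarrow> x = 0"
  shows "inj_on T W"
proof (rule inj_onI)
  fix x y assume xy: "x \<in> W" "y \<in> W" "T x = T y"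
  have "x - y \<in> W" using W xy by (simp add: representation_def subspace_diff)
  moreover have "T (x - y) + T y = T x"
    using T xy calculation unfolding intertwiner_def linear_between_def by (metis diff_add_cancel)
  ultimately show "x = y" using ker[of "x - y"] xy by auto
qed

text \<open>The kernel of \<open>T\<close> is not everything, hence trivial; the image is not trivial, hence
  everything.\<close>

lemma Schur:
  assumes W: "irreducible_rep G W \<rho>" and W': "irreducible_rep G W' \<rho>'"
    and T: "intertwiner G W \<rho> W' \<rho>' T" and nz: "x \<in> W" "T x \<noteq> 0"
  shows "rep_isomorphic G W \<rho> W' \<rho>'"
proof -
  have r: "representation G W \<rho>" "representation G W' \<rho>'"
    using W W' by (auto simp: irreducible_rep_def)
  have "{x \<in> W. T x = 0} = {0}"
    using subrepresentation_kernel[OF r T] W nz unfolding irreducible_rep_def by blast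
  then have inj: "inj_on T W"
    by (intro intertwiner_inj_on[OF r(1) T]) auto
  have "T ` W = W'"
    using subrepresentation_image[OF r(1) T] W' nz unfolding irreducible_rep_def by blast
  then show ?thesis
    using T inj unfolding rep_isomorphic_def bij_betw_def by blast
qed

lemma inverse_intertwiner:
  assumes W: "representation G W \<rho>" and T: "intertwiner G W \<rho> W' \<rho>' T" and b: "bij_betw T W W'"
  shows "intertwiner G W' \<rho>' W \<rho> (inv_into W T)"
proof -
  have inv: "T (inv_into W T y) = y" "inv_into W T y \<in> W" if "y \<in> W'" for y
    using b that by (auto simp: bij_betw_def f_inv_into_f inv_into_into)
  have eq: "inv_into W T y = x" if "x \<in> W" "T x = y" for x y
    using b that by (auto simp: bij_betw_def)
  show ?thesis
    unfolding intertwiner_def linear_between_def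
    using W T inv unfolding intertwiner_def representation_def linear_between_def
    by (auto intro!: eq simp: subspace_add subspace_scale)
qed

lemma rep_isomorphic_sym:
  assumes "representation G W \<rho>" and "rep_isomorphic G W \<rho> W' \<rho>'"
  shows "rep_isomorphic G W' \<rho>' W \<rho>"
  using assms inverse_intertwiner bij_betw_inv_into unfolding rep_isomorphic_def by blast

lemma rep_isomorphic_trans:
  assumes "rep_isomorphic G W \<rho> W' \<rho>'" and "rep_isomorphic G W' \<rho>' W'' \<rho>''"
  shows "rep_isomorphic G W \<rho> W'' \<rho>''"
proof -
  obtain S T where "intertwiner G W \<rho> W' \<rho>' S" "bij_betw S W W'"
    "intertwiner G W' \<rho>' W'' \<rho>'' T" "bij_betw T W' W''"
    using assms unfolding rep_isomorphic_def by blast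
  then show ?thesis
    unfolding rep_isomorphic_def
    using intertwiner_comp[of G W \<rho> W' \<rho>' S W'' \<rho>'' T] bij_betw_trans[of S W W' T W'']
    by (auto simp: o_def)
qed

lemma irreducible_rep_isomorphic:
  assumes W: "irreducible_rep G W \<rho>" and W': "representation G W' \<rho>'"
    and iso: "rep_isomorphic G W \<rho> W' \<rho>'"
  shows "irreducible_rep G W' \<rho>'"
proof -
  have r: "representation G W \<rho>" using W by (simp add: irreducible_rep_def)
  obtain T where T: "intertwiner G W' \<rho>' W \<rho> T" "bij_betw T W' W"
    using rep_isomorphic_sym[OF r iso] unfolding rep_isomorphic_def by blast
  have zero: "T 0 = 0" "0 \<in> W'"
    using T W' linear_between_zero unfolding intertwiner_def representation_def
    by (blast, simp add: subspace_0)
  have "W' \<noteq> {0}"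
    using T(2) zero W unfolding irreducible_rep_def bij_betw_def by auto
  moreover have "S = {0} \<or> S = W'" if S: "subrepresentation G W' \<rho>' S" for S
  proof -
    have SW: "S \<subseteq> W'" "0 \<in> S" using S by (auto simp: subrepresentation_def subspace_0)
    have "subrepresentation G W \<rho> (T ` S)"
      using subrepresentation_image representation_subrep[OF W' S] intertwiner_mono[OF T(1) SW(1)]
      by blast
    then have "T ` S = {0} \<or> T ` S = W"
      using W by (simp add: irreducible_rep_def)
    moreover have "S = {0}" if "T ` S = T ` {0}"
      using inj_on_image_eq_iff[of T W' S "{0}"] that SW zero T(2) by (auto simp: bij_betw_def)
    moreover have "S = W'" if "T ` S = T ` W'"
      using inj_on_image_eq_iff[of T W' S W'] that SW T(2) by (auto simp: bij_betw_def)
    ultimately show ?thesis using zero T(2) by (auto simp: bij_betw_def)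
  qed
  ultimately show ?thesis using W' by (simp add: irreducible_rep_def)
qed

lemma rep_isomorphic_dim:
  assumes "representation G W \<rho>" and "rep_isomorphic G W \<rho> W' \<rho>'"
  shows "dim W' = dim W"
proof -
  obtain T where T: "intertwiner G W \<rho> W' \<rho>' T" "bij_betw T W W'"
    using assms unfolding rep_isomorphic_def by blast
  have W: "subspace W" using assms(1) by (rule representation_subspace)
  obtain F where F: "linear F" "\<And>x. x \<in> W \<Longrightarrow> F x = T x"
    using intertwiner_extension[OF assms(1) T(1)] by metis
  have "inj_on F (span W)"
    using T(2) F(2) inj_on_cong[of W F T] W by (simp add: bij_betw_def span_eq_iff[THEN iffD2])
  moreover have "F ` W = W'"
    using T(2) F(2) by (simp add: bij_betw_def cong: image_cong)
  ultimately show ?thesis using dim_image_eq[OF F(1), of W] by simp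
qed

text \<open>evaluate\<close>

text \<open>Bounds the real dimension of the line spanned by \<open>z\<close> over the division algebra. Conjugation
  with an isomorphism identifies the endomorphisms of \<open>V\<close> with matrices in \<open>End_rep G U \<rho>\<close>, and
  evaluation at \<open>z\<close> is linear in the matrix.\<close>

lemma dim_evaluate_intertwiners_le:
  fixes U :: "(real^'k) set" and V :: "(real^'l) set"
  assumes U: "representation G U \<rho>" and iso: "rep_isomorphic G U \<rho> V \<tau>" and z: "z \<in> V"
  shows "dim {f z | f. intertwiner G V \<tau> V \<tau> f} \<le> dim (End_rep G U \<rho>)"
proof -
  obtain T where T: "intertwiner G U \<rho> V \<tau> T" "bij_betw T U V"
    using iso unfolding rep_isomorphic_def by blast
  let ?T' = "inv_into U T"
  have T': "intertwiner G V \<tau> U \<rho> ?T'" by (rule inverse_intertwiner[OF U T])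
  have inv: "T (?T' y) = y" "?T' y \<in> U" if "y \<in> V" for y
    using T(2) that by (auto simp: bij_betw_def f_inv_into_f inv_into_into)
  obtain F where F: "linear F" "\<And>x. x \<in> U \<Longrightarrow> F x = T x"
    using intertwiner_extension[OF U T(1)] by metis
  define ev where "ev A = F (A *v ?T' z)" for A :: "real^'k^'k"
  have ev: "linear ev"
    by (rule linearI) (simp_all add: ev_def matrix_vector_mult_add_rdistrib linear_add[OF F(1)]
        scaleR_matrix_vector_assoc[symmetric] linear_scale[OF F(1)])
  have "f z \<in> ev ` End_rep G U \<rho>" if f: "intertwiner G V \<tau> V \<tau> f" for f
  proof -
    let ?g = "\<lambda>x. ?T' (f (T x))"
    have g: "intertwiner G U \<rho> U \<rho> ?g"
      by (intro intertwiner_comp[OF _ T'] intertwiner_comp[OF T(1) f])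
    obtain H where H: "linear H" "\<And>x. x \<in> U \<Longrightarrow> H x = ?g x"
      "\<And>x. x \<in> orthogonal_comp U \<Longrightarrow> H x = 0"
      using intertwiner_extension[OF U g] by blast
    have mH: "matrix H *v x = H x" for x
      using H(1) by (simp add: matrix_works linear_matrix_vector_mul_eq)
    have "intertwiner G U \<rho> U \<rho> ((*v) (matrix H))"
      by (rule intertwiner_cong[OF U g]) (simp add: mH H(2))
    then have A: "matrix H \<in> End_rep G U \<rho>"
      unfolding End_rep_def by (auto simp: mH H(3))
    have "ev (matrix H) = f z"
      using z inv intertwiner_in[OF f] by (simp add: ev_def mH H(2) F(2))
    then show ?thesis using A by force
  qed
  then have "{f z | f. intertwiner G V \<tau> V \<tau> f} \<subseteq> ev ` End_rep G U \<rho>" by blast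
  then show ?thesis
    using dim_subset dim_image_le[OF ev] le_trans by blast
qed

section \<open>Orthogonal representations\<close>

locale orthogonal_rep = group G for G :: "('g, 'm) monoid_scheme" (structure) +
  fixes \<tau> :: "'g \<Rightarrow> real^'v::finite \<Rightarrow> real^'v"
  assumes rep: "representation G UNIV \<tau>"
    and isometric: "g \<in> carrier G \<Longrightarrow> \<tau> g x \<bullet> \<tau> g y = x \<bullet> y"
begin

lemma intertwiner_id: "intertwiner G V \<tau> V \<tau> (\<lambda>x. x)"
  by (simp add: intertwiner_def linear_between_def)

text \<open>The adjoint is equivariant because isometries satisfy
  \<open>\<tau> g x \<bullet> y = x \<bullet> \<tau> (inv g) y\<close>.\<close>

lemma adjoint_intertwiner:
  assumes V: "representation G V \<tau>" and f: "intertwiner G V \<tau> UNIV \<tau> f"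
  obtains f' where "intertwiner G UNIV \<tau> V \<tau> f'" "\<And>x y. x \<in> V \<Longrightarrow> f x \<bullet> y = x \<bullet> f' y"
proof -
  have subV: "subspace V" using V by (rule representation_subspace)
  obtain f' where f': "linear f'" "\<And>y. f' y \<in> V" "\<And>x y. x \<in> V \<Longrightarrow> f x \<bullet> y = x \<bullet> f' y"
    using linear_between_adjoint[OF _ subV, of UNIV f] f unfolding intertwiner_def by blast
  have "f' (\<tau> g y) = \<tau> g (f' y)" if g: "g \<in> carrier G" for g y
  proof -
    have inV: "\<tau> k x \<in> V" if "k \<in> carrier G" "x \<in> V" for k x
      using V that unfolding representation_def linear_between_def by blast
    have ginv: "inv g \<in> carrier G" using g by simp
    have cancel: "\<tau> g (\<tau> (inv g) x) = x" for x
      using rep g ginv r_inv[OF g] unfolding representation_def by (metis UNIV_I)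
    have "x \<bullet> f' (\<tau> g y) = x \<bullet> \<tau> g (f' y)" if x: "x \<in> V" for x
    proof -
      have "x \<bullet> f' (\<tau> g y) = f x \<bullet> \<tau> g y" using f'(3)[OF x] by simp
      also have "\<dots> = \<tau> g (f (\<tau> (inv g) x)) \<bullet> \<tau> g y"
        using f ginv x cancel unfolding intertwiner_def by simp
      also have "\<dots> = \<tau> (inv g) x \<bullet> f' y"
        using isometric[OF g] f'(3) inV[OF ginv x] by simp
      also have "\<dots> = x \<bullet> \<tau> g (f' y)"
        using isometric[OF g, of "\<tau> (inv g) x"] cancel by simp
      finally show ?thesis .
    qed
    moreover have "f' (\<tau> g y) - \<tau> g (f' y) \<in> V"
      using f'(2) inV[OF g] subV by (simp add: subspace_diff)
    ultimately have "(f' (\<tau> g y) - \<tau> g (f' y)) \<bullet> (f' (\<tau> g y) - \<tau> g (f' y)) = 0"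
      by (simp add: inner_diff_right)
    then show ?thesis by simp
  qed
  then have "intertwiner G UNIV \<tau> V \<tau> f'"
    using f'(1,2) by (simp add: intertwiner_def linear_between_def linear_add linear_scale)
  then show thesis using that f'(3) by blast
qed

lemma adjoint_endomorphism:
  assumes V: "representation G V \<tau>" and f: "intertwiner G V \<tau> V \<tau> f"
  obtains f' where "intertwiner G V \<tau> V \<tau> f'" "\<And>x y. x \<in> V \<Longrightarrow> f x \<bullet> y = x \<bullet> f' y"
proof -
  obtain f' where f': "intertwiner G UNIV \<tau> V \<tau> f'" "\<And>x y. x \<in> V \<Longrightarrow> f x \<bullet> y = x \<bullet> f' y"
    using adjoint_intertwiner[OF V intertwiner_mono[OF f order_refl subset_UNIV]] by blast
  show thesis
    using that[OF intertwiner_mono[OF f'(1) subset_UNIV order_refl] f'(2)] by blast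
qed

text \<open>The maximum \<open>c\<close> of the Rayleigh quotient \<open>x \<bullet> f x / (x \<bullet> x)\<close> is attained by compactness, and
  the maximiser is an eigenvector. The eigenspace of \<open>c\<close> is then a nonzero subrepresentation, hence
  all of \<open>V\<close>.\<close>

lemma selfadjoint_endomorphism_scalar:
  assumes V: "irreducible_rep G V \<tau>" and f: "intertwiner G V \<tau> V \<tau> f"
    and sa: "\<And>x y. x \<in> V \<Longrightarrow> y \<in> V \<Longrightarrow> x \<bullet> f y = f x \<bullet> y"
  obtains c where "\<And>x. x \<in> V \<Longrightarrow> f x = c *\<^sub>R x"
proof -
  have rV: "representation G V \<tau>" using V by (rule irreducible_rep_representation)
  then have subV: "subspace V" by (rule representation_subspace)
  obtain F where F: "linear F" "\<And>x. x \<in> V \<Longrightarrow> F x = f x"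
    using intertwiner_extension[OF rV f] by metis
  let ?S = "V \<inter> sphere 0 1"
  have "compact ?S" using closed_subspace[OF subV] by (simp add: closed_Int_compact)
  moreover have "?S \<noteq> {}"
  proof -
    obtain v where v: "v \<in> V" "v \<noteq> 0"
      using V subspace_0[OF subV] unfolding irreducible_rep_def by blast
    then have "(1 / norm v) *\<^sub>R v \<in> ?S" using subV by (simp add: subspace_scale)
    then show ?thesis by blast
  qed
  moreover have "continuous_on ?S (\<lambda>x. x \<bullet> F x)"
    using F(1) by (intro continuous_intros linear_continuous_on) (simp add: linear_conv_bounded_linear)
  ultimately obtain v where v: "v \<in> ?S" "\<And>x. x \<in> ?S \<Longrightarrow> x \<bullet> F x \<le> v \<bullet> F v"
    using continuous_attains_sup[of ?S "\<lambda>x. x \<bullet> F x"] by metis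
  define c where "c = v \<bullet> F v"
  have v1: "v \<in> V" "v \<bullet> v = 1" using v(1) by (auto simp: dot_square_norm)
  have bound: "x \<bullet> F x \<le> c * (x \<bullet> x)" if "x \<in> V" for x
  proof (cases "x = 0")
    case False
    let ?u = "(1 / norm x) *\<^sub>R x"
    have "?u \<in> ?S" using that subV False by (simp add: subspace_scale)
    then have "?u \<bullet> F ?u \<le> c" unfolding c_def by (rule v(2))
    then have "x \<bullet> F x / (norm x)\<^sup>2 \<le> c"
      using F(1) by (simp add: linear_scale power2_eq_square)
    then show ?thesis
      using False by (simp add: field_simps dot_square_norm)
  qed (use F(1) in \<open>simp add: linear_0\<close>)
  \<comment> \<open>Moving from the maximiser \<open>v\<close> in the direction of its defect \<open>d\<close> cannot increase the quotient;
    the first-order term of this statement is \<open>d \<bullet> d\<close>, so the defect vanishes.\<close>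
  define d where "d = c *\<^sub>R v - F v"
  have fV: "F x \<in> V" if "x \<in> V" for x
    using intertwiner_in[OF f that] F(2)[OF that] by simp
  have dV: "d \<in> V" using v1(1) fV subV by (simp add: d_def subspace_diff subspace_scale)
  define e where "e = c * (d \<bullet> d) - d \<bullet> F d"
  have e: "e \<ge> 0" using bound[OF dV] by (simp add: e_def)
  have quad: "0 \<le> 2 * t * (d \<bullet> d) + t\<^sup>2 * e" for t
  proof -
    have "v + t *\<^sub>R d \<in> V" using v1 dV subV by (simp add: subspace_add subspace_scale)
    from bound[OF this]
    have ineq: "v \<bullet> F v + t * (v \<bullet> F d) + t * (d \<bullet> F v) + t\<^sup>2 * (d \<bullet> F d)
        \<le> c * (v \<bullet> v) + 2 * t * (c * (v \<bullet> d)) + t\<^sup>2 * (c * (d \<bullet> d))"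
      using F(1) by (simp add: linear_add linear_scale inner_add_left inner_add_right
          power2_eq_square algebra_simps inner_commute)
    have e1: "v \<bullet> F d = d \<bullet> F v"
      using sa[OF v1(1) dV] F(2) v1(1) dV by (simp add: inner_commute)
    have e2: "c * (v \<bullet> d) = d \<bullet> d + d \<bullet> F v"
      by (simp add: d_def inner_diff_left inner_diff_right inner_commute right_diff_distrib)
    show ?thesis
      using ineq[unfolded e1 e2] v1(2) by (simp add: c_def[symmetric] e_def algebra_simps)
  qed
  have "d \<bullet> d = 0"
  proof (rule ccontr)
    assume "d \<bullet> d \<noteq> 0"
    then have pos: "d \<bullet> d > 0" by simp
    \<comment> \<open>Essentially the minimiser of the quadratic in \<open>t\<close>; the summand 1 covers the case \<open>e = 0\<close>.\<close>
    let ?t = "- (d \<bullet> d) / (e + 1)"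
    have "2 * ?t * (d \<bullet> d) + ?t\<^sup>2 * e = - (d \<bullet> d)\<^sup>2 * (e + 2) / (e + 1)\<^sup>2"
      using e by (simp add: power2_eq_square divide_simps) (simp add: algebra_simps)
    also have "\<dots> < 0" using e pos by (intro divide_neg_pos mult_neg_pos) auto
    finally show False using quad[of ?t] by simp
  qed
  then have Fv: "F v = c *\<^sub>R v" by (simp add: d_def)
  have "intertwiner G V \<tau> V \<tau> (\<lambda>x. f x + (- c) *\<^sub>R x)"
    by (intro intertwiner_add[OF rV f] intertwiner_scaleR[OF rV] intertwiner_id)
  then have "subrepresentation G V \<tau> {x \<in> V. f x + (- c) *\<^sub>R x = 0}"
    by (rule subrepresentation_kernel[OF rV rV])
  moreover have "v \<in> {x \<in> V. f x + (- c) *\<^sub>R x = 0}" "v \<noteq> 0"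
    using v1 Fv F(2) by auto
  ultimately have "{x \<in> V. f x + (- c) *\<^sub>R x = 0} = V"
    using V unfolding irreducible_rep_def by blast
  then have "f x + (- c) *\<^sub>R x = 0" if "x \<in> V" for x
    using that by blast
  then show thesis
    using that[of c] by simp
qed

text \<open>Only the self-adjoint part of \<open>f\<close> contributes to \<open>x \<bullet> f x\<close>, and it is a scalar. This is the
  shadow of the fact that the division algebra is \<open>\<real>\<close>, the complex numbers or the quaternions, with
  adjoints as conjugation.\<close>

lemma endomorphism_quadratic_form:
  assumes V: "irreducible_rep G V \<tau>" and f: "intertwiner G V \<tau> V \<tau> f"
  obtains c where "\<And>x. x \<in> V \<Longrightarrow> x \<bullet> f x = c * (x \<bullet> x)"
proof -
  have rV: "representation G V \<tau>" using V by (rule irreducible_rep_representation)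
  obtain f' where f': "intertwiner G V \<tau> V \<tau> f'" "\<And>x y. x \<in> V \<Longrightarrow> f x \<bullet> y = x \<bullet> f' y"
    using adjoint_endomorphism[OF rV f] by blast
  have "x \<bullet> (f y + f' y) = (f x + f' x) \<bullet> y" if "x \<in> V" "y \<in> V" for x y
    using f'(2)[OF that(1), of y] f'(2)[OF that(2), of x]
    by (simp add: inner_add_left inner_add_right inner_commute)
  then obtain c where c: "\<And>x. x \<in> V \<Longrightarrow> f x + f' x = c *\<^sub>R x"
    using selfadjoint_endomorphism_scalar[OF V intertwiner_add[OF rV f f'(1)]] by metis
  have "x \<bullet> f x = (c / 2) * (x \<bullet> x)" if x: "x \<in> V" for x
    using arg_cong[OF c[OF x], of "\<lambda>w. x \<bullet> w"] f'(2)[OF x, of x]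
    by (simp add: inner_add_right inner_commute)
  then show thesis using that by blast
qed

section \<open>Gram matrices over the division algebra\<close>

text \<open>With the division algebra as scalars, the numbers \<open>z \<bullet> f z'\<close> for all \<open>f\<close> encode the hermitian
  product of \<open>z\<close> and \<open>z'\<close>. The relation says that this product equals that of \<open>(x, y)\<close> and
  \<open>(x', y')\<close> in the orthogonal sum of two copies of \<open>V\<close>. As it compares two sesquilinear forms, it is
  compatible with sums and scalars in each argument; triples make this a statement about a
  single relation.\<close>

definition gram_agree :: "(real^'v) set \<Rightarrow> (real^'v) \<times> (real^'v) \<times> (real^'v) \<Rightarrow>
    (real^'v) \<times> (real^'v) \<times> (real^'v) \<Rightarrow> bool" where
  "gram_agree V = (\<lambda>(z, x, y) (z', x', y').
     \<forall>f. intertwiner G V \<tau> V \<tau> f \<longrightarrow> z \<bullet> f z' = x \<bullet> f x' + y \<bullet> f y')"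

lemma gram_agree_sym:
  assumes V: "representation G V \<tau>" and "gram_agree V p q" "p \<in> V \<times> V \<times> V" "q \<in> V \<times> V \<times> V"
  shows "gram_agree V q p"
proof -
  obtain z x y z' x' y' where p: "p = (z, x, y)" and q: "q = (z', x', y')"
    by (metis prod_cases3)
  have "z' \<bullet> f z = x' \<bullet> f x + y' \<bullet> f y" if f: "intertwiner G V \<tau> V \<tau> f" for f
  proof -
    obtain f' where f': "intertwiner G V \<tau> V \<tau> f'" "\<And>x y. x \<in> V \<Longrightarrow> f x \<bullet> y = x \<bullet> f' y"
      using adjoint_endomorphism[OF V f] by blast
    have "f z \<bullet> z' = f x \<bullet> x' + f y \<bullet> y'"
      using assms(2-) f' by (simp add: gram_agree_def p q)
    then show ?thesis by (simp add: inner_commute)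
  qed
  then show ?thesis by (simp add: gram_agree_def p q)
qed

lemma gram_agree_add:
  "gram_agree V p r \<Longrightarrow> gram_agree V q r \<Longrightarrow> gram_agree V (p + q) r"
  by (cases p; cases q; cases r) (simp add: gram_agree_def inner_add_left)

lemma gram_agree_act:
  assumes V: "representation G V \<tau>" and g: "intertwiner G V \<tau> V \<tau> g"
    and "gram_agree V (z, x, y) r" "z \<in> V" "x \<in> V" "y \<in> V"
  shows "gram_agree V (g z, g x, g y) r"
proof -
  obtain g' where g': "intertwiner G V \<tau> V \<tau> g'" "\<And>x y. x \<in> V \<Longrightarrow> g x \<bullet> y = x \<bullet> g' y"
    using adjoint_endomorphism[OF V g] by blast
  show ?thesis
    using assms(3-) g'(2) intertwiner_comp[OF _ g'(1), of V \<tau>]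
    by (auto simp: gram_agree_def split: prod.splits)
qed

lemma gram_agree_sum:
  fixes n :: nat
  assumes V: "representation G V \<tau>"
    and "\<And>k. k < n \<Longrightarrow> intertwiner G V \<tau> V \<tau> (g k)"
    and "\<And>k. k < n \<Longrightarrow> gram_agree V (z k, x k, y k) r"
    and "\<And>k. k < n \<Longrightarrow> z k \<in> V \<and> x k \<in> V \<and> y k \<in> V"
  shows "gram_agree V (\<Sum>k<n. g k (z k), \<Sum>k<n. g k (x k), \<Sum>k<n. g k (y k)) r"
  using assms(2-)
proof (induction n)
  case 0
  then show ?case by (auto simp: gram_agree_def)
next
  case (Suc n)
  then show ?case
    using gram_agree_add[OF Suc.IH gram_agree_act[OF V, of "g n" "z n" "x n" "y n"]] by simp
qed

text \<open>A tuple of \<open>m\<close> vectors of \<open>V \<times> V\<close> has an isometric copy in \<open>V\<close> if \<open>m\<close> is at most the dimension of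
  \<open>V\<close> over its division algebra. Here \<open>\<delta>\<close> bounds the real dimension of the lines over the division algebra, so
  that \<open>m - 1\<close> lines never fill \<open>V\<close>. The induction adds one vector
  at a time, splitting it into a combination of the previous ones and an orthogonal rest.\<close>

lemma gram_realization:
  assumes V: "irreducible_rep G V \<tau>"
    and orbit_dim: "\<And>v. v \<in> V \<Longrightarrow> dim {f v | f. intertwiner G V \<tau> V \<tau> f} \<le> \<delta>"
    and le: "m * \<delta> \<le> dim V"
    and xy: "\<And>k. k < m \<Longrightarrow> x k \<in> V" "\<And>k. k < m \<Longrightarrow> y k \<in> V"
  shows "\<exists>z. (\<forall>k<m. z k \<in> V) \<and>
    (\<forall>k<m. \<forall>l<m. gram_agree V (z k, x k, y k) (z l, x l, y l))"
  using le xy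
proof (induction m)
  case 0
  then show ?case by simp
next
  case (Suc n)
  let ?D = "\<lambda>f. intertwiner G V \<tau> V \<tau> f"
  have rV: "representation G V \<tau>" using V by (rule irreducible_rep_representation)
  then have subV: "subspace V" by (rule representation_subspace)
  have xyV: "x k \<in> V" "y k \<in> V" if "k \<le> n" for k
    using Suc.prems that by auto
  have "n * \<delta> \<le> dim V" using Suc.prems(1) by simp
  then obtain z where z': "\<forall>k<n. z k \<in> V"
    "\<forall>k<n. \<forall>l<n. gram_agree V (z k, x k, y k) (z l, x l, y l)"
    using Suc.IH xyV by fastforce
  then have z: "\<And>k. k < n \<Longrightarrow> z k \<in> V"
    and agree: "\<And>k l. k < n \<Longrightarrow> l < n \<Longrightarrow> gram_agree V (z k, x k, y k) (z l, x l, y l)"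
    by auto
  let ?C = "\<lambda>f w. \<Sum>k<n. f k (w k)"
  \<comment> \<open>The span of the previous vectors \<open>(x k, y k)\<close> over the division algebra.\<close>
  define M where "M = {(?C f x, ?C f y) | f. \<forall>k<n. ?D (f k)}"
  have "subspace M"
    unfolding subspace_def
  proof (intro conjI ballI allI)
    show "0 \<in> M"
      unfolding M_def using intertwiner_zero[OF rV]
      by (auto intro!: exI[of _ "\<lambda>_ _. 0"] simp: zero_prod_def)
  next
    fix p q assume "p \<in> M" "q \<in> M"
    then obtain f g where "p = (?C f x, ?C f y)" "q = (?C g x, ?C g y)"
      "\<forall>k<n. ?D (f k)" "\<forall>k<n. ?D (g k)"
      unfolding M_def by blast
    moreover from this have "\<forall>k<n. ?D (\<lambda>w. f k w + g k w)"
      by (simp add: intertwiner_add[OF rV])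
    ultimately show "p + q \<in> M"
      unfolding M_def by (auto intro!: exI[of _ "\<lambda>k w. f k w + g k w"] simp: sum.distrib)
  next
    fix c p assume "p \<in> M"
    then obtain f where "p = (?C f x, ?C f y)" "\<forall>k<n. ?D (f k)"
      unfolding M_def by blast
    moreover from this have "\<forall>k<n. ?D (\<lambda>w. c *\<^sub>R f k w)"
      by (simp add: intertwiner_scaleR[OF rV])
    ultimately show "c *\<^sub>R p \<in> M"
      unfolding M_def by (auto intro!: exI[of _ "\<lambda>k w. c *\<^sub>R f k w"] simp: scaleR_sum_right)
  qed
  then have spanM: "span M = M" by simp
  obtain s t where "s \<in> M" and orth: "\<And>w. w \<in> M \<Longrightarrow> orthogonal t w" and split: "(x n, y n) = s + t"
    using orthogonal_subspace_decomp_exists[of M "(x n, y n)"] spanM by metis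
  then obtain f where f: "\<And>k. k < n \<Longrightarrow> ?D (f k)" "s = (?C f x, ?C f y)"
    unfolding M_def by blast
  obtain x' y' where t: "t = (x', y')" by (cases t)
  have xn: "x n = ?C f x + x'" and yn: "y n = ?C f y + y'"
    using split f(2) t by auto
  have CV: "?C f w \<in> V" if "\<And>k. k < n \<Longrightarrow> w k \<in> V" for w
    using f(1) that by (intro subspace_sum[OF subV]) (auto intro: intertwiner_in)
  have x'V: "x' \<in> V" and y'V: "y' \<in> V"
    using subspace_diff[OF subV xyV(1)[of n] CV[of x]] subspace_diff[OF subV xyV(2)[of n] CV[of y]]
      xyV xn yn by auto
  have t_orth: "x' \<bullet> g (x k) + y' \<bullet> g (y k) = 0" if "k < n" "?D g" for g k
  proof -
    let ?f = "\<lambda>j. if j = k then g else (\<lambda>_. 0)"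
    have "?C ?f w = g (w k)" for w :: "nat \<Rightarrow> real^'v"
    proof -
      have "?C ?f w = (\<Sum>j<n. if j = k then g (w j) else 0)"
        by (intro sum.cong) auto
      then show ?thesis using that(1) by simp
    qed
    moreover have "\<forall>j<n. ?D (?f j)" using that(2) intertwiner_zero[OF rV] by auto
    ultimately have "(g (x k), g (y k)) \<in> M"
      unfolding M_def by (auto intro!: exI[of _ ?f])
    then show ?thesis using orth t by (force simp: orthogonal_def)
  qed
  \<comment> \<open>The copy of the orthogonal rest \<open>(x', y')\<close>. The vectors to avoid span at most \<open>n * \<delta>\<close>
    dimensions, and \<open>n * \<delta> < dim V\<close> because one more line over the division algebra fits into \<open>V\<close>.\<close>
  obtain u where u: "u \<in> V" "u \<bullet> u = x' \<bullet> x' + y' \<bullet> y'"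
    and u_orth: "\<And>k g. k < n \<Longrightarrow> ?D g \<Longrightarrow> u \<bullet> g (z k) = 0"
  proof -
    let ?S = "\<Union>k<n. {g (z k) | g. ?D g}"
    have SV: "?S \<subseteq> V" using z by (auto intro: intertwiner_in)
    have "dim ?S \<le> n * \<delta>" using orbit_dim z by (intro dim_UN_le) auto
    also have "\<dots> < dim V"
    proof (cases "\<delta> = 0")
      case True
      then show ?thesis
        using V subspace_0[OF subV] unfolding irreducible_rep_def by (auto simp: neq0_conv[symmetric])
    next
      case False
      then show ?thesis using Suc.prems(1) by simp
    qed
    finally have lt: "dim ?S < dim V" .
    have "span ?S \<noteq> span V"
    proof
      assume "span ?S = span V"
      then have "dim (span ?S) = dim (span V)" by (rule arg_cong)
      then show False using lt by (simp only: dim_span less_irrefl)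
    qed
    moreover have "span ?S \<subseteq> span V" using SV by (rule span_mono)
    ultimately obtain v where v: "v \<noteq> 0" "v \<in> span V" "\<And>w. w \<in> span ?S \<Longrightarrow> orthogonal v w"
      using orthogonal_to_subspace_exists_gen[of ?S V] by auto
    define c where "c = sqrt (x' \<bullet> x' + y' \<bullet> y') / norm v"
    have "c *\<^sub>R v \<in> V" using v(2) subV by (simp add: span_eq_iff[THEN iffD2] subspace_scale)
    moreover have "(c *\<^sub>R v) \<bullet> (c *\<^sub>R v) = x' \<bullet> x' + y' \<bullet> y'"
      using v(1) by (simp add: c_def dot_square_norm power2_eq_square[symmetric] power_divide)
    moreover have "(c *\<^sub>R v) \<bullet> g (z k) = 0" if "k < n" "?D g" for k g
      using v(3)[OF span_base, of "g (z k)"] that by (auto simp: orthogonal_def)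
    ultimately show thesis using that by blast
  qed
  \<comment> \<open>The new vector: the coefficients \<open>f\<close> express \<open>(x n, y n)\<close> by the previous vectors up to the
    rest, so the same coefficients are applied to \<open>z\<close>. In terms of triples it is \<open>q + r\<close>.\<close>
  define w where "w = ?C f z + u"
  define p where "p k = (z k, x k, y k)" for k
  define q where "q = (?C f z, ?C f x, ?C f y)"
  define r where "r = (u, x', y')"
  have pn: "(w, x n, y n) = q + r" by (simp add: w_def q_def r_def xn yn)
  have inV: "q \<in> V \<times> V \<times> V" "r \<in> V \<times> V \<times> V" "q + r \<in> V \<times> V \<times> V"
    "\<And>k. k < n \<Longrightarrow> p k \<in> V \<times> V \<times> V"
    using CV[of z] CV[of x] CV[of y] z xyV u(1) x'V y'V subV
    by (auto simp: p_def q_def r_def subspace_add)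
  have sym: "gram_agree V a b \<Longrightarrow> a \<in> V \<times> V \<times> V \<Longrightarrow> b \<in> V \<times> V \<times> V \<Longrightarrow> gram_agree V b a" for a b
    by (rule gram_agree_sym[OF rV])
  have q_any: "gram_agree V q a" if "\<And>k. k < n \<Longrightarrow> gram_agree V (p k) a" for a
    unfolding q_def using f(1) that z xyV
    by (intro gram_agree_sum[OF rV]) (auto simp: p_def)
  have rp: "gram_agree V r (p k)" if "k < n" for k
    using u_orth t_orth that by (simp add: r_def p_def gram_agree_def)
  have rr: "gram_agree V r r"
  proof -
    have "u \<bullet> g u = x' \<bullet> g x' + y' \<bullet> g y'" if g: "?D g" for g
    proof -
      obtain c where c: "\<And>v. v \<in> V \<Longrightarrow> v \<bullet> g v = c * (v \<bullet> v)"
        using endomorphism_quadratic_form[OF V g] by blast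
      show ?thesis using c u x'V y'V by (simp add: distrib_left)
    qed
    then show ?thesis by (simp add: r_def gram_agree_def)
  qed
  have qp: "gram_agree V q (p k)" if "k < n" for k
    using q_any agree that by (simp add: p_def)
  have qr: "gram_agree V q r"
    using q_any sym rp inV by blast
  have qq: "gram_agree V q q"
    using q_any sym qp inV by blast
  have last: "gram_agree V (q + r) (p k)" if "k < n" for k
    by (rule gram_agree_add[OF qp[OF that] rp[OF that]])
  have last_sym: "gram_agree V (p k) (q + r)" if "k < n" for k
    by (rule sym[OF last[OF that] inV(3) inV(4)[OF that]])
  have rq: "gram_agree V r q"
    by (rule sym[OF qr inV(1,2)])
  have "gram_agree V q (q + r)" "gram_agree V r (q + r)"
    using sym[OF gram_agree_add[OF qq rq] inV(3,1)] sym[OF gram_agree_add[OF qr rr] inV(3,2)]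
    by simp_all
  then have last_last: "gram_agree V (q + r) (q + r)"
    by (rule gram_agree_add)
  let ?z = "z(n := w)"
  have "?z k \<in> V" if "k < Suc n" for k
    using z CV[of z] u(1) subV that by (auto simp: w_def subspace_add less_Suc_eq)
  moreover have "gram_agree V (?z k, x k, y k) (?z l, x l, y l)" if "k < Suc n" "l < Suc n" for k l
    using that agree last last_sym last_last
    by (auto simp: pn[symmetric] p_def less_Suc_eq)
  ultimately show ?case by blast
qed

section \<open>Sums of invariant quadratic forms\<close>

text \<open>The hermitian Gram matrices of \<open>m\<close>-tuples in \<open>V\<close> are closed under addition.\<close>

definition gram_matrices_add :: "(real^'v) set \<Rightarrow> nat \<Rightarrow> bool" where
  "gram_matrices_add V m \<longleftrightarrow> (\<forall>x y. (\<forall>k<m. x k \<in> V) \<longrightarrow> (\<forall>k<m. y k \<in> V) \<longrightarrow>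
     (\<exists>z. (\<forall>k<m. z k \<in> V) \<and> (\<forall>k<m. \<forall>l<m. gram_agree V (z k, x k, y k) (z l, x l, y l))))"

text \<open>The abstract irreducible representation \<open>U\<close>, whose action need not be isometric, is replaced
  by its image \<open>V\<close> under the first of the \<open>m\<close> embeddings of \<open>U\<close> into \<open>X\<close>. For \<open>m = 0\<close> there is no such
  embedding, but then \<open>X\<close> is zero and any \<open>V\<close> will do.\<close>

lemma isotypic_copy:
  fixes U :: "(real^'k) set"
  assumes U: "irreducible_rep G U \<rho>" and iso: "isomorphic_to_multiple G X \<tau> m U \<rho>"
    and m: "real m \<le> dim_over_End G U \<rho>"
  shows "\<exists>V K. (m > 0 \<longrightarrow> irreducible_rep G V \<tau> \<and> rep_isomorphic G U \<rho> V \<tau>) \<and>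
    (\<forall>k<m. intertwiner G V \<tau> X \<tau> (K k)) \<and>
    (\<forall>\<phi>\<in>X. \<exists>x. (\<forall>k<m. x k \<in> V) \<and> \<phi> = (\<Sum>k<m. K k (x k))) \<and>
    (\<forall>x. (\<forall>k<m. x k \<in> V) \<longrightarrow> (\<Sum>k<m. K k (x k)) \<in> X) \<and>
    gram_matrices_add V m"
proof -
  obtain J where J: "\<And>k. k < m \<Longrightarrow> intertwiner G U \<rho> X \<tau> (J k)"
    and bij: "bij_betw (\<lambda>y. \<Sum>k<m. J k (y k)) ({..<m} \<rightarrow>\<^sub>E U) X"
    using iso unfolding isomorphic_to_multiple_def by blast
  have rU: "representation G U \<rho>" using U by (rule irreducible_rep_representation)
  then have subU: "subspace U" by (rule representation_subspace)
  show ?thesis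
  proof (cases "m = 0")
    case True
    then have "X = {0}" using bij by (auto simp: bij_betw_def)
    then show ?thesis using True by (simp add: gram_matrices_add_def)
  next
    case False
    let ?a = "J 0" and ?b = "inv_into U (J 0)"
    let ?V = "J 0 ` U"
    have J0: "J k 0 = 0" if "k < m" for k
      using linear_between_zero[OF _ subU] J[OF that] by (auto simp: intertwiner_def)
    \<comment> \<open>Injectivity of the first embedding: tuples concentrated in position 0 are determined by
      their image in \<open>X\<close>.\<close>
    have ker: "v = 0" if v: "v \<in> U" "?a v = 0" for v
    proof -
      define y where "y w = (\<lambda>k\<in>{..<m}. if k = 0 then w else 0)" for w :: "real^'k"
      have "(\<Sum>k<m. J k (y w k)) = ?a w" for w
      proof -
        have "(\<Sum>k<m. J k (y w k)) = (\<Sum>k<m. if k = 0 then ?a w else 0)"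
          using J0 by (intro sum.cong) (auto simp: y_def)
        then show ?thesis using False by simp
      qed
      then have "(\<Sum>k<m. J k (y v k)) = (\<Sum>k<m. J k (y 0 k))"
        using v(2) J0[of 0] False by simp
      moreover have "y w \<in> {..<m} \<rightarrow>\<^sub>E U" if "w \<in> U" for w
        using that subU by (auto simp: y_def subspace_0)
      then have "y v \<in> {..<m} \<rightarrow>\<^sub>E U" "y 0 \<in> {..<m} \<rightarrow>\<^sub>E U"
        using v(1) subspace_0[OF subU] by blast+
      ultimately have "y v = y 0"
        using bij_betw_imp_inj_on[OF bij] by (blast dest: inj_onD)
      then have "y v 0 = y 0 0" by simp
      then show ?thesis using False by (simp add: y_def)
    qed
    have inj: "inj_on ?a U"
      using intertwiner_inj_on[OF rU J[of 0]] ker False by blast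
    then have bij0: "bij_betw ?a U ?V" by (simp add: bij_betw_def)
    have rV: "representation G ?V \<tau>"
      using subrepresentation_image[OF rU, of UNIV \<tau> ?a] J[of 0] False
        intertwiner_mono[OF J[of 0] order_refl subset_UNIV] representation_subrep[OF rep] by blast
    have Ja: "intertwiner G U \<rho> ?V \<tau> ?a"
      using J[of 0] False unfolding intertwiner_def linear_between_def by auto
    have isoV: "rep_isomorphic G U \<rho> ?V \<tau>"
      using Ja bij0 unfolding rep_isomorphic_def by blast
    have irrV: "irreducible_rep G ?V \<tau>"
      by (rule irreducible_rep_isomorphic[OF U rV isoV])
    have b: "intertwiner G ?V \<tau> U \<rho> ?b"
      by (rule inverse_intertwiner[OF rU Ja bij0])
    let ?K = "\<lambda>k v. J k (?b v)"
    have K: "\<forall>k<m. intertwiner G ?V \<tau> X \<tau> (?K k)"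
      using J intertwiner_comp[OF b] by blast
    have cover: "\<exists>x. (\<forall>k<m. x k \<in> ?V) \<and> \<phi> = (\<Sum>k<m. ?K k (x k))" if "\<phi> \<in> X" for \<phi>
    proof -
      have "\<phi> \<in> (\<lambda>y. \<Sum>k<m. J k (y k)) ` ({..<m} \<rightarrow>\<^sub>E U)"
        using that bij_betw_imp_surj_on[OF bij] by simp
      then have "\<exists>y. y \<in> {..<m} \<rightarrow>\<^sub>E U \<and> \<phi> = (\<Sum>k<m. J k (y k))"
        by (rule imageE) blast
      then obtain y where y: "y \<in> {..<m} \<rightarrow>\<^sub>E U" "\<phi> = (\<Sum>k<m. J k (y k))"
        by blast
      have yU: "y k \<in> U" if "k < m" for k
        using PiE_mem[OF y(1), of k] that by simp
      have "\<phi> = (\<Sum>k<m. ?K k (?a (y k)))"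
        unfolding y(2) using yU inj by (intro sum.cong) (simp_all add: inv_into_f_f)
      moreover have "\<forall>k<m. ?a (y k) \<in> ?V"
        using yU by blast
      ultimately show ?thesis
        by (intro exI[of _ "\<lambda>k. ?a (y k)"] conjI)
    qed
    have into: "(\<Sum>k<m. ?K k (x k)) \<in> X" if "\<forall>k<m. x k \<in> ?V" for x
    proof -
      have "(\<lambda>k\<in>{..<m}. ?b (x k)) \<in> {..<m} \<rightarrow>\<^sub>E U"
        using that intertwiner_in[OF b] by auto
      then have "(\<Sum>k<m. J k ((\<lambda>k\<in>{..<m}. ?b (x k)) k)) \<in> X"
        by (rule bij_betw_apply[OF bij])
      then show ?thesis by simp
    qed
    let ?d = "dim (End_rep G U \<rho>)"
    have "m * ?d \<le> dim U"
    proof -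
      \<comment> \<open>If the dimension were zero, \<open>dim_over_End\<close> would be a division by zero, hence 0, against
        \<open>m > 0\<close>.\<close>
      have "?d > 0" using m False by (cases "?d = 0") (auto simp: dim_over_End_def)
      then have "real m * real ?d \<le> real (dim U)"
        using m by (simp add: dim_over_End_def field_simps)
      then show ?thesis by (metis of_nat_le_iff of_nat_mult)
    qed
    then have md: "m * ?d \<le> dim ?V" using rep_isomorphic_dim[OF rU isoV] by simp
    have "gram_matrices_add ?V m"
      unfolding gram_matrices_add_def
    proof (intro allI impI)
      fix x y :: "nat \<Rightarrow> real^'v"
      assume "\<forall>k<m. x k \<in> ?V" "\<forall>k<m. y k \<in> ?V"
      then show "\<exists>z. (\<forall>k<m. z k \<in> ?V) \<and>
          (\<forall>k<m. \<forall>l<m. gram_agree ?V (z k, x k, y k) (z l, x l, y l))"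
        by (intro gram_realization[OF irrV _ md] dim_evaluate_intertwiners_le[OF rU isoV]) auto
    qed
    then show ?thesis
      by (intro exI[of _ ?V] exI[of _ ?K]) (use irrV isoV K cover into in blast)
  qed
qed

text \<open>After expanding \<open>\<theta>\<close> into coordinates \<open>z i k\<close> in the copies \<open>V i\<close>, the form becomes a sum of terms
  \<open>z i k \<bullet> T (z j l)\<close> with an intertwiner \<open>T\<close> from \<open>V j\<close> to \<open>V i\<close>. For \<open>i = j\<close> these are
  entries of Gram matrices, which can be added; for \<open>i \<noteq> j\<close> they vanish by Schur's lemma.\<close>

lemma invariant_forms_add:
  fixes U :: "nat \<Rightarrow> (real^'k::finite) set"
  assumes dec: "isotypic_decomposition G W \<tau> h X m U \<rho>"
    and mult: "\<forall>i\<in>{1..h}. real (m i) \<le> dim_over_End G (U i) (\<rho> i)"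
    and \<phi>: "\<phi> \<in> W" and \<psi>: "\<psi> \<in> W"
  obtains \<theta> where "\<theta> \<in> W"
    "\<And>Q. intertwiner G UNIV \<tau> UNIV \<tau> Q \<Longrightarrow> \<theta> \<bullet> Q \<theta> = \<phi> \<bullet> Q \<phi> + \<psi> \<bullet> Q \<psi>"
proof -
  let ?I = "{1..h}"
  have bij: "bij_betw (\<lambda>x. \<Sum>i\<in>?I. x i) (\<Pi>\<^sub>E i\<in>?I. X i) W"
    and irrU: "\<And>i. i \<in> ?I \<Longrightarrow> irreducible_rep G (U i) (\<rho> i)"
    and noniso: "\<And>i j. i \<in> ?I \<Longrightarrow> j \<in> ?I \<Longrightarrow> i \<noteq> j \<Longrightarrow> \<not> rep_isomorphic G (U i) (\<rho> i) (U j) (\<rho> j)"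
    and iso: "\<And>i. i \<in> ?I \<Longrightarrow> isomorphic_to_multiple G (X i) \<tau> (m i) (U i) (\<rho> i)"
    using dec unfolding isotypic_decomposition_def direct_sum_decomposition_def by blast+
  \<comment> \<open>The properties of a copy, packed into one predicate to choose \<open>V i\<close> and \<open>K i\<close> for all \<open>i\<close>.\<close>
  define P where "P i V K \<longleftrightarrow>
    (m i > 0 \<longrightarrow> irreducible_rep G V \<tau> \<and> rep_isomorphic G (U i) (\<rho> i) V \<tau>) \<and>
    (\<forall>k<m i. intertwiner G V \<tau> (X i) \<tau> (K k)) \<and>
    (\<forall>\<phi>\<in>X i. \<exists>x. (\<forall>k<m i. x k \<in> V) \<and> \<phi> = (\<Sum>k<m i. K k (x k))) \<and>
    (\<forall>x. (\<forall>k<m i. x k \<in> V) \<longrightarrow> (\<Sum>k<m i. K k (x k)) \<in> X i) \<and>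
    gram_matrices_add V (m i)" for i V and K :: "nat \<Rightarrow> real^'v \<Rightarrow> real^'v"
  have "\<exists>V K. P i V K" if "i \<in> ?I" for i
    unfolding P_def using isotypic_copy[OF irrU[OF that] iso[OF that]] mult that by blast
  then obtain V K where "\<And>i. i \<in> ?I \<Longrightarrow> P i (V i) (K i)"
    by metis
  then have irrV: "\<And>i. i \<in> ?I \<Longrightarrow> m i > 0 \<Longrightarrow> irreducible_rep G (V i) \<tau>"
    and isoV: "\<And>i. i \<in> ?I \<Longrightarrow> m i > 0 \<Longrightarrow> rep_isomorphic G (U i) (\<rho> i) (V i) \<tau>"
    and K: "\<And>i k. i \<in> ?I \<Longrightarrow> k < m i \<Longrightarrow> intertwiner G (V i) \<tau> (X i) \<tau> (K i k)"
    and cover: "\<And>i \<phi>. i \<in> ?I \<Longrightarrow> \<phi> \<in> X i \<Longrightarrow>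
      \<exists>x. (\<forall>k<m i. x k \<in> V i) \<and> \<phi> = (\<Sum>k<m i. K i k (x k))"
    and into: "\<And>i x. i \<in> ?I \<Longrightarrow> \<forall>k<m i. x k \<in> V i \<Longrightarrow> (\<Sum>k<m i. K i k (x k)) \<in> X i"
    and gram: "\<And>i. i \<in> ?I \<Longrightarrow> gram_matrices_add (V i) (m i)"
    unfolding P_def by blast+
  let ?F = "\<lambda>x. \<Sum>i\<in>?I. \<Sum>k<m i. K i k (x i k)"
  let ?coords = "\<lambda>x. \<forall>i\<in>?I. \<forall>k<m i. x i k \<in> V i"
  have expand: "\<exists>x. ?coords x \<and> w = ?F x" if w: "w \<in> W" for w
  proof -
    have "w \<in> (\<lambda>x. \<Sum>i\<in>?I. x i) ` (\<Pi>\<^sub>E i\<in>?I. X i)"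
      using bij_betw_imp_surj_on[OF bij] w by simp
    then obtain p where p: "p \<in> (\<Pi>\<^sub>E i\<in>?I. X i)" "w = (\<Sum>i\<in>?I. p i)" by blast
    have "\<exists>x. (\<forall>k<m i. x k \<in> V i) \<and> p i = (\<Sum>k<m i. K i k (x k))" if "i \<in> ?I" for i
      by (rule cover[OF that PiE_mem[OF p(1) that]])
    then obtain x where x: "\<And>i. i \<in> ?I \<Longrightarrow> (\<forall>k<m i. x i k \<in> V i) \<and> p i = (\<Sum>k<m i. K i k (x i k))"
      by metis
    then have "w = ?F x" unfolding p(2) by (intro sum.cong) auto
    then show ?thesis using x by blast
  qed
  have recombine: "?F x \<in> W" if x: "?coords x" for x
  proof -
    have "(\<lambda>i\<in>?I. \<Sum>k<m i. K i k (x i k)) \<in> (\<Pi>\<^sub>E i\<in>?I. X i)"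
      using into x by simp
    then have "(\<Sum>i\<in>?I. (\<lambda>i\<in>?I. \<Sum>k<m i. K i k (x i k)) i) \<in> W"
      by (rule bij_betw_apply[OF bij])
    then show ?thesis by simp
  qed
  obtain x where x: "?coords x" "\<phi> = ?F x" using expand[OF \<phi>] by blast
  obtain y where y: "?coords y" "\<psi> = ?F y" using expand[OF \<psi>] by blast
  have "\<exists>z. (\<forall>k<m i. z k \<in> V i) \<and>
      (\<forall>k<m i. \<forall>l<m i. gram_agree (V i) (z k, x i k, y i k) (z l, x i l, y i l))" if "i \<in> ?I" for i
    using gram[OF that] x(1) y(1) that unfolding gram_matrices_add_def by simp
  then obtain z where z': "\<And>i. i \<in> ?I \<Longrightarrow> (\<forall>k<m i. z i k \<in> V i) \<and>
      (\<forall>k<m i. \<forall>l<m i. gram_agree (V i) (z i k, x i k, y i k) (z i l, x i l, y i l))"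
    by metis
  then have z: "?coords z"
    and agree: "\<And>i k l. i \<in> ?I \<Longrightarrow> k < m i \<Longrightarrow> l < m i \<Longrightarrow>
      gram_agree (V i) (z i k, x i k, y i k) (z i l, x i l, y i l)"
    by blast+
  have "?F z \<bullet> Q (?F z) = \<phi> \<bullet> Q \<phi> + \<psi> \<bullet> Q \<psi>" if Q: "intertwiner G UNIV \<tau> UNIV \<tau> Q" for Q
  proof -
    have linQ: "linear Q"
      using Q by (simp add: linearI intertwiner_def linear_between_def)
    let ?A = "Sigma ?I (\<lambda>i. {..<m i})"
    define \<kappa> where "\<kappa> w = (\<lambda>(i, k). K i k (w i k))" for w
    define b where "b w p q = \<kappa> w p \<bullet> Q (\<kappa> w q)" for w p q
    have pair: "b z p q = b x p q + b y p q"
      if pq: "p \<in> ?A" "q \<in> ?A" for p q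
    proof -
      obtain i k j l where p: "p = (i, k)" "i \<in> ?I" "k < m i" and q: "q = (j, l)" "j \<in> ?I" "l < m j"
        using pq by auto
      have rV: "representation G (V i) \<tau>"
        using irrV[OF p(2)] p(3) by (auto intro: irreducible_rep_representation)
      obtain K' where K': "intertwiner G UNIV \<tau> (V i) \<tau> K'"
        "\<And>v w. v \<in> V i \<Longrightarrow> K i k v \<bullet> w = v \<bullet> K' w"
        using adjoint_intertwiner[OF rV intertwiner_mono[OF K[OF p(2,3)] order_refl subset_UNIV]]
        by blast
      define T where "T v = K' (Q (K j l v))" for v
      have T: "intertwiner G (V j) \<tau> (V i) \<tau> T"
        unfolding T_def
        by (rule intertwiner_comp[OF intertwiner_comp[OF
              intertwiner_mono[OF K[OF q(2,3)] order_refl subset_UNIV] Q] K'(1)])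
      have b: "b w p q = w i k \<bullet> T (w j l)" if "?coords w" for w
        using K'(2) that p q by (simp add: b_def \<kappa>_def T_def)
      show ?thesis
      proof (cases "i = j")
        case True
        then have "z i k \<bullet> T (z i l) = x i k \<bullet> T (x i l) + y i k \<bullet> T (y i l)"
          using agree[OF p(2,3), of l] q(3) T by (simp add: gram_agree_def)
        then show ?thesis using b x(1) y(1) z True by simp
      next
        case False
        have irr: "irreducible_rep G (V i) \<tau>" "irreducible_rep G (V j) \<tau>"
          using irrV p q by auto
        have "\<not> rep_isomorphic G (V j) \<tau> (V i) \<tau>"
        proof
          assume "rep_isomorphic G (V j) \<tau> (V i) \<tau>"
          moreover have "rep_isomorphic G (U j) (\<rho> j) (V j) \<tau>"
            using isoV q by auto
          moreover have "rep_isomorphic G (V i) \<tau> (U i) (\<rho> i)"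
            using isoV[OF p(2)] p(3) irreducible_rep_representation[OF irrU[OF p(2)]]
            by (auto intro: rep_isomorphic_sym)
          ultimately have "rep_isomorphic G (U j) (\<rho> j) (U i) (\<rho> i)"
            by (blast intro: rep_isomorphic_trans)
          then show False using noniso p(2) q(2) False by blast
        qed
        then have "T v = 0" if "v \<in> V j" for v
          using Schur[OF irr(2,1) T that] by blast
        then have "b w p q = 0" if "?coords w" for w
          using b that q by simp
        then show ?thesis using x(1) y(1) z by simp
      qed
    qed
    have form: "?F w \<bullet> Q (?F w) = (\<Sum>p\<in>?A. \<Sum>q\<in>?A. b w p q)" for w
    proof -
      have "?F w = (\<Sum>p\<in>?A. \<kappa> w p)"
        by (simp add: \<kappa>_def sum.Sigma)
      then show ?thesis
        by (simp only: linear_sum[OF linQ] inner_sum_left b_def) (simp only: inner_sum_right)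
    qed
    show ?thesis
      unfolding x(2) y(2) form sum.distrib[symmetric] using pair by (intro sum.cong refl)
  qed
  then show thesis using that recombine[OF z] by blast
qed

end

section \<open>Edge orbits and their energies\<close>

lemma laplacian_vertex_action:
  assumes E: "simple_graph E" and s: "bij s" "\<And>u v. {s u, s v} \<in> E \<longleftrightarrow> {u, v} \<in> E"
  shows "laplacian E *v vertex_action s x = vertex_action s (laplacian E *v x)"
proof -
  let ?t = "inv_into UNIV s"
  have st: "s (?t u) = u" "?t (s u) = u" for u
    using s(1) by (simp_all add: bij_is_surj surj_f_inv_f bij_is_inj)
  have "(\<Sum>v | {u, v} \<in> E. x $ ?t u - x $ ?t v) = (\<Sum>v | {?t u, v} \<in> E. x $ ?t u - x $ v)" for u
    by (rule sum.reindex_bij_witness[of _ s ?t]) (use s(2) st in \<open>auto, metis+\<close>)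
  then show ?thesis
    by (simp add: vec_eq_iff laplacian_mult[OF E] vertex_action_def)
qed

lemma orthogonal_rep_vertex_action:
  assumes "subgroup \<Psi> (Aut E)"
  shows "orthogonal_rep ((Aut E)\<lparr>carrier := \<Psi>\<rparr>) vertex_action"
proof -
  have "vertex_action s x \<bullet> vertex_action s y = x \<bullet> y" if "s \<in> \<Psi>" for s x y
  proof -
    have "bij s" using subgroup.subset[OF assms] that by (auto simp: Aut_def)
    then have "bij (inv_into UNIV s)" by (rule bij_imp_bij_inv)
    then show ?thesis
      using sum.reindex_bij_betw[of "inv_into UNIV s" UNIV UNIV "\<lambda>u. x $ u * y $ u"]
      by (simp add: inner_vec_def vertex_action_def)
  qed
  then show ?thesis
    using subgroup.subgroup_is_group[OF assms group_Aut] representation_vertex_action[OF assms]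
    by (simp add: orthogonal_rep_def orthogonal_rep_axioms_def)
qed

lemma edge_orbitE:
  assumes "Or \<in> edge_orbits E \<Psi>"
  obtains e where "e \<in> E" "Or = (\<lambda>\<sigma>. \<sigma> ` e) ` \<Psi>"
  using assms by (auto simp: edge_orbits_def orbits_def orbit_def image_def Bex_def)

lemma edge_orbit_nonempty:
  assumes "subgroup \<Psi> (Aut E)" and "Or \<in> edge_orbits E \<Psi>"
  shows "Or \<noteq> {}"
  using edge_orbitE[OF assms(2)] subgroup.one_closed[OF assms(1)] by (metis empty_iff image_is_empty)

lemma simple_graph_edge_orbit:
  assumes E: "simple_graph E" and \<Psi>: "subgroup \<Psi> (Aut E)" and "Or \<in> edge_orbits E \<Psi>"
  shows "simple_graph Or"
proof -
  obtain e where e: "e \<in> E" "Or = (\<lambda>\<sigma>. \<sigma> ` e) ` \<Psi>" using edge_orbitE[OF assms(3)] by metis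
  have "inj_on \<sigma> e" if "\<sigma> \<in> \<Psi>" for \<sigma>
    using subgroup.subset[OF \<Psi>] that by (auto simp: Aut_def bij_def intro: inj_on_subset)
  then show ?thesis using E e by (auto simp: simple_graph_def card_image)
qed

text \<open>Thus the group also acts by automorphisms of the graph formed by a single edge orbit.\<close>

lemma edge_orbit_invariant:
  assumes \<Psi>: "subgroup \<Psi> (Aut E)" and "Or \<in> edge_orbits E \<Psi>" and s: "s \<in> \<Psi>"
  shows "{s u, s v} \<in> Or \<longleftrightarrow> {u, v} \<in> Or"
proof -
  obtain e where Or: "Or = (\<lambda>\<sigma>. \<sigma> ` e) ` \<Psi>" using edge_orbitE[OF assms(2)] by metis
  have closed: "g ` d \<in> Or" if g: "g \<in> \<Psi>" and d: "d \<in> Or" for g d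
  proof -
    obtain \<sigma> where "\<sigma> \<in> \<Psi>" "d = \<sigma> ` e" using d Or by blast
    moreover from this have "g \<circ> \<sigma> \<in> \<Psi>"
      using subgroup.m_closed[OF \<Psi> g] by (simp add: Aut_def)
    ultimately show ?thesis unfolding Or
      by (intro image_eqI[of _ _ "g \<circ> \<sigma>"]) (simp_all add: image_comp)
  qed
  let ?t = "inv\<^bsub>Aut E\<^esub> s"
  have t: "?t \<in> \<Psi>" using \<Psi> s by (rule subgroup.m_inv_closed)
  have "?t \<otimes>\<^bsub>Aut E\<^esub> s = \<one>\<^bsub>Aut E\<^esub>"
    using group.l_inv[OF group_Aut] subgroup.subset[OF \<Psi>] s by blast
  then have "?t \<circ> s = id" by (simp add: Aut_def)
  then have "?t (s w) = w" for w by (metis comp_apply id_apply)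
  then show ?thesis
    using closed[OF s, of "{u, v}"] closed[OF t, of "{s u, s v}"] by auto
qed

text \<open>The squared distance in \<open>\<real>\<^sup>r\<close> is the sum over the coordinate functions, so averaging it over an
  orbit yields the sum of their orbit energies.\<close>

lemma sum_on_edge_L2_set:
  fixes \<phi> :: "nat \<Rightarrow> real^'v::finite"
  assumes "simple_graph D"
  shows "(\<Sum>e\<in>D. on_edge (\<lambda>u v. (L2_set (\<lambda>j. \<phi> j $ u - \<phi> j $ v) {..<r})\<^sup>2) e)
    = (\<Sum>j<r. \<Sum>e\<in>D. on_edge (\<lambda>u v. (\<phi> j $ u - \<phi> j $ v)\<^sup>2) e)"
proof -
  have "on_edge (\<lambda>u v. (L2_set (\<lambda>j. \<phi> j $ u - \<phi> j $ v) {..<r})\<^sup>2) e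
      = (\<Sum>j<r. on_edge (\<lambda>u v. (\<phi> j $ u - \<phi> j $ v)\<^sup>2) e)" if "e \<in> D" for e
  proof -
    have "card e = 2" using assms that by (simp add: simple_graph_def)
    then obtain u v where e: "e = {u, v}" by (auto simp: card_2_iff)
    have L2: "(L2_set (\<lambda>j. \<phi> j $ u - \<phi> j $ v) {..<r})\<^sup>2 = (\<Sum>j<r. (\<phi> j $ u - \<phi> j $ v)\<^sup>2)" for u v
      by (simp add: L2_set_def sum_nonneg)
    show ?thesis
      unfolding e L2 by (subst (1 2) on_edge_eq) (auto simp: power2_commute intro: sum.cong)
  qed
  then show ?thesis by (subst sum.swap) (simp cong: sum.cong)
qed

lemma convex_cone_sum:
  fixes C :: "'a::real_vector set"
  assumes "convex_cone C" and "\<And>j. j < r \<Longrightarrow> f j \<in> C"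
  shows "(\<Sum>j<(r::nat). f j) \<in> C"
  using assms(2) by (induction r) (auto simp: convex_cone_contains_0[OF assms(1)] intro: convex_cone_add[OF assms(1)])

section \<open>The cone of orbit energies\<close>

theorem theorem6p7:
  fixes E :: "'v::finite set set"
    and \<Psi> :: "('v \<Rightarrow> 'v) set"
    and lam :: real
    and Orb :: "'s::finite \<Rightarrow> 'v set set"
    and h :: nat
    and X :: "nat \<Rightarrow> (real^'v) set"
    and m :: "nat \<Rightarrow> nat"
    and U :: "nat \<Rightarrow> (real^'k::finite) set"
    and \<rho> :: "nat \<Rightarrow> ('v \<Rightarrow> 'v) \<Rightarrow> real^'k \<Rightarrow> real^'k"
  assumes "simple_graph E" and "connected_graph E"
    and "subgroup \<Psi> (Aut E)"
    and "lam > 0" and "laplacian_eigenvalue E lam"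
    and "bij_betw Orb UNIV (edge_orbits E \<Psi>)"
    and "isotypic_decomposition ((Aut E)\<lparr>carrier := \<Psi>\<rparr>) (eigenspace E lam) vertex_action h X m U \<rho>"
    and "\<forall>i\<in>{1..h}. real (m i) \<le> dim_over_End ((Aut E)\<lparr>carrier := \<Psi>\<rparr>) (U i) (\<rho> i)"
  shows "convex_cone (orbit_energy Orb ` eigenspace E lam) \<and>
         (has_orbit_isometric_embedding Orb (eigenspace E lam) \<longleftrightarrow>
          (\<exists>\<phi>\<in>eigenspace E lam. orbit_energy Orb \<phi> = orbit_sizes Orb))"
proof -
  let ?G = "(Aut E)\<lparr>carrier := \<Psi>\<rparr>" and ?W = "eigenspace E lam" and ?ell = "orbit_energy Orb"
  have \<Psi>: "subgroup \<Psi> (Aut E)" and E: "simple_graph E" by fact+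
  interpret orthogonal_rep ?G vertex_action
    by (rule orthogonal_rep_vertex_action[OF \<Psi>])
  have Orb: "Orb i \<in> edge_orbits E \<Psi>" for i
    using assms(6) by (auto simp: bij_betw_def)
  have simple: "simple_graph (Orb i)" for i
    by (rule simple_graph_edge_orbit[OF E \<Psi> Orb])
  have card_pos: "card (Orb i) > 0" for i
    using edge_orbit_nonempty[OF \<Psi> Orb] by (simp add: card_gt_0_iff)
  have subW: "subspace ?W"
    using subrepresentation_eigenspace[OF \<Psi> E] by (simp add: subrepresentation_def)
  have energy: "?ell \<phi> $ i = \<phi> \<bullet> (laplacian (Orb i) *v \<phi>)" for \<phi> i
    by (simp add: orbit_energy_def laplacian_quadratic_form[OF simple])
  have lap: "intertwiner ?G UNIV vertex_action UNIV vertex_action ((*v) (laplacian (Orb i)))" for i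
  proof -
    have "laplacian (Orb i) *v vertex_action s x = vertex_action s (laplacian (Orb i) *v x)"
      if "s \<in> \<Psi>" for s x
      using subgroup.subset[OF \<Psi>] that
      by (intro laplacian_vertex_action[OF simple] edge_orbit_invariant[OF \<Psi> Orb]) (auto simp: Aut_def)
    then show ?thesis
      by (simp add: intertwiner_def linear_between_def matrix_vector_right_distrib
          matrix_vector_mult_scaleR)
  qed
  have scale: "?ell (sqrt c *\<^sub>R \<phi>) = c *\<^sub>R ?ell \<phi>" if "c \<ge> 0" for c \<phi>
    using that by (simp add: vec_eq_iff energy matrix_vector_mult_scaleR)
  have cone: "convex_cone (?ell ` ?W)"
    unfolding convex_cone_iff
  proof (intro conjI ballI allI impI)
    have "?ell 0 = 0" by (simp add: vec_eq_iff energy)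
    then show "0 \<in> ?ell ` ?W"
      using subspace_0[OF subW] by (metis imageI)
  next
    fix a b assume "a \<in> ?ell ` ?W" "b \<in> ?ell ` ?W"
    then obtain \<phi> \<psi> where \<phi>: "\<phi> \<in> ?W" "a = ?ell \<phi>" and \<psi>: "\<psi> \<in> ?W" "b = ?ell \<psi>" by blast
    obtain \<theta> where "\<theta> \<in> ?W" and \<theta>: "\<And>Q. intertwiner ?G UNIV vertex_action UNIV vertex_action Q \<Longrightarrow>
        \<theta> \<bullet> Q \<theta> = \<phi> \<bullet> Q \<phi> + \<psi> \<bullet> Q \<psi>"
      using invariant_forms_add[OF assms(7,8) \<phi>(1) \<psi>(1)] by blast
    moreover have "?ell \<theta> = a + b"
      using \<theta>[OF lap] by (simp add: vec_eq_iff energy \<phi>(2) \<psi>(2))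
    ultimately show "a + b \<in> ?ell ` ?W" by (metis imageI)
  next
    fix a and c :: real assume "a \<in> ?ell ` ?W" "c \<ge> 0"
    then obtain \<phi> where \<phi>: "\<phi> \<in> ?W" "a = ?ell \<phi>" by blast
    have "c *\<^sub>R a = ?ell (sqrt c *\<^sub>R \<phi>)" using scale[OF \<open>c \<ge> 0\<close>] \<phi>(2) by simp
    then show "c *\<^sub>R a \<in> ?ell ` ?W"
      using subspace_scale[OF subW \<phi>(1)] by blast
  qed
  have isometric_iff: "orbit_isometric Orb r \<phi> \<longleftrightarrow>
      (\<exists>c>0. (\<Sum>j<r. ?ell (\<phi> j)) = c *\<^sub>R orbit_sizes Orb)" for r \<phi>
  proof -
    have avg: "1 / real (card (Orb i)) * t = c \<longleftrightarrow> t = c * real (card (Orb i))" for i t c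
      using card_pos[of i] by (auto simp: field_simps)
    show ?thesis
      by (simp only: orbit_isometric_def sum_on_edge_L2_set[OF simple] avg)
        (simp add: vec_eq_iff orbit_sizes_def orbit_energy_def)
  qed
  have "(\<exists>\<phi>\<in>?W. ?ell \<phi> = orbit_sizes Orb)" if emb: "has_orbit_isometric_embedding Orb ?W"
  proof -
    obtain r \<phi> where \<phi>: "\<forall>j<r. \<phi> j \<in> ?W" and "orbit_isometric Orb r \<phi>"
      using emb unfolding has_orbit_isometric_embedding_def by auto
    then obtain c where "c > 0" and sum: "(\<Sum>j<r. ?ell (\<phi> j)) = c *\<^sub>R orbit_sizes Orb"
      unfolding isometric_iff by auto
    have "(\<Sum>j<r. ?ell (\<phi> j)) \<in> ?ell ` ?W"
      using \<phi> by (intro convex_cone_sum[OF cone]) blast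
    then obtain \<psi> where "\<psi> \<in> ?W" "?ell \<psi> = c *\<^sub>R orbit_sizes Orb"
      unfolding sum by (metis imageE)
    then have "sqrt (1 / c) *\<^sub>R \<psi> \<in> ?W" "?ell (sqrt (1 / c) *\<^sub>R \<psi>) = orbit_sizes Orb"
      using \<open>c > 0\<close> scale[of "1 / c" \<psi>] subspace_scale[OF subW] by auto
    then show ?thesis by blast
  qed
  moreover have "has_orbit_isometric_embedding Orb ?W" if "\<phi> \<in> ?W" "?ell \<phi> = orbit_sizes Orb" for \<phi>
    unfolding has_orbit_isometric_embedding_def isometric_iff
    using that by (intro exI[of _ 1] exI[of _ "\<lambda>_. \<phi>"]) (auto intro: exI[of _ 1])
  ultimately show ?thesis using cone by blast
qed

end
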